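(* Let $n\ge2$, $p\ge 1$ be integers, and let $(Y_i,X_i^{(1)},\ldots,X_i^{(p)})_{1\le i\le n}$ be $n$ independent copies of a random vector $(Y,X^{(1)},\ldots,X^{(p)})$ of square integrable real random variables with $\mathrm{Var}(X^{(j)})>0$ for all $j$. Let $q\in(0,1)$, $\gamma=\Phi^{-1}(1-q/2)$, $\mathcal M^*=\{j\in\{1,\ldots,p\}:\mathrm{Cov}(X^{(j)},Y)\ne0\}$, ${\mathcal M^*}^c=\{1,\ldots,p\}\setminus\mathcal M^*$ (assumed non-empty) and $\widehat{\mathcal M}=\{j\in\{1,\ldots,p\}:\sqrt n|\hat\tau_j|/\sqrt{\widehat v_j}\ge\gamma\}$. Assume that for every $j\in{\mathcal M^*}^c$ all the norms appearing in the definitions of $K$ and $H_1,\ldots,H_5$ at $(X^{(j)},Y)$ are finite and all the denominators are non-zero (with the convention of the context for the terms of $K$ having $|\tau|$ in the denominator). Then $$\begin{aligned}\left|\mathbb E\left[\frac{|{\mathcal M^*}^c\cap\widehat{\mathcal M}|}{|{\mathcal M^*}^c|}\right]-q\right|\le\ &\frac{\log(n)}{\sqrt n}\max_{j\in{\mathcal M^*}^c}\left(2H_1(X^{(j)},Y)\right)+\frac1{\sqrt n}\max_{j\in{\mathcal M^*}^c}\left(2H_2(X^{(j)},Y)\right)\\&+\frac1{\sqrt{n\log(n)}}\max_{j\in{\mathcal M^*}^c}\left(2H_3(X^{(j)},Y)\right)+\frac1n\max_{j\in{\mathcal M^*}^c}\left(2H_4(X^{(j)},Y)\right)+\frac1{n^{3/2}}\max_{j\in{\mathcal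 M^*}^c}\left(2H_5(X^{(j)},Y)\right).\end{aligned}$$
   Context: Notation. $\Phi$ is the standard Gaussian cumulative distribution function; $\|Z\|_p=(\mathbb E|Z|^p)^{1/p}$; $|A|$ is the cardinality of a finite set $A$. With $\overline X^{(j)}=\frac1n\sum_iX_i^{(j)}$, $\overline Y=\frac1n\sum_iY_i$, $$\hat\tau_j=\frac{\sum_{i=1}^n(X_i^{(j)}-\overline X^{(j)})(Y_i-\overline Y)}{\sum_{i=1}^n(X_i^{(j)}-\overline X^{(j)})^2},\quad \hat b_j=\overline Y-\hat\tau_j\overline X^{(j)},\quad \hat\varepsilon_i^{(j)}=Y_i-\hat b_j-\hat\tau_jX_i^{(j)},$$ $$\widehat v_j=\frac{n^{-1}\sum_{i=1}^n(X_i^{(j)}-\overline X^{(j)})^2(\hat\varepsilon_i^{(j)})^2}{\left(n^{-1}\sum_{i=1}^n(X_i^{(j)}-\overline X^{(j)})^2\right)^2}.$$ On events where a denominator vanishes the ratio is given an arbitrary fixed value (e.g. $0$). Constants. $c_{BE}>0$ is a universal constant such that the Berry-Esseen inequality $\sup_x|\mathbb P(\sqrt n\,\overline Z/\sigma_Z\le x)-\Phi(x)|\le c_{BE}\,\mathbb E|Z_1|^3/(\sigma_Z^3\sqrt n)$ holds for every $n\geq 1$ and all i.i.d. centered $Z_1,\dots,Z_n$ with finite third moment, $\overline Z=\frac1n\sum Z_i$ and $\sigma_Z^2=\mathrm{Var}(Z_1)>0$. $c_{1,R},c_{2,R}>0$ are universal constants such that Rosenthal's inequality $\left\|\frac1n\sum_{i=1}^nZ_i\right\|_q\le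 c_{1,R}\sqrt q\,\sqrt{\mathrm{Var}(Z_1)/n}+c_{2,R}\,q\,n^{-(q-1)/q}\|Z_1\|_q$ holds for every $q\ge2$, $n\ge 1$ and all i.i.d. centered $Z_1,\dots,Z_n$ with $\|Z_1\|_q<\infty$. For a generic couple $(X,Y)$ put $\tilde X=X-\mathbb E(X)$, $\tilde Y=Y-\mathbb E(Y)$, $\sigma_X^2=\mathrm{Var}(X)$, $\sigma_Y^2=\mathrm{Var}(Y)$, $\tau=\mathrm{Cov}(X,Y)/\mathrm{Var}(X)$, $\varepsilon=\tilde Y-\tau\tilde X$, $\sigma_\varepsilon^2=\mathrm{Var}(\varepsilon)$, and $K=K(X,Y)$ is $$K=\frac{\|\tilde X\varepsilon\|_2}{4}\min\Big(\tfrac{\|\tilde X\varepsilon\|_2}{36\|\tilde X^2\tilde Y\|_1\sigma_Y},\tfrac{\|\tilde X\varepsilon\|_2\sigma_X}{72\|\tilde X^2\tilde Y\|_1\sigma_Y},\tfrac{\|\tilde X\varepsilon\|_2\sigma_X}{72\|\tilde X\|_3^3\sigma_Y^2},\tfrac{\|\tilde X\varepsilon\|_2}{36|\tau|\|\tilde X\|_3^3\sigma_Y},\tfrac{\sigma_X^2}{288\|\tilde X^3\tilde Y\|_1},\tfrac{\sigma_X^3}{288\|\tilde X\|_4^4\sigma_Y},\tfrac{\sigma_X^2}{72|\tau|\|\tilde X\|_4^4},\tfrac{\|\tilde X\varepsilon\|_2}{\|\tilde X\varepsilon\|_4^2},\tfrac{\|\tilde X\varepsilon\|_2}{8\|\tilde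 Y^2\tilde X\|_1\sigma_X}\Big),$$ where, if $\tau=0$ (as is the case for the couples $(X^{(j)},Y)$ with $j\in{\mathcal M^*}^c$), the two terms with $|\tau|$ in the denominator are $+\infty$ (i.e. omitted from the minimum). Moreover $$H_1(X,Y)=\frac{3\sigma_\varepsilon\sigma_X}{\sqrt{2\pi}\|\tilde X\varepsilon\|_2}+\frac1{\sqrt{2\pi}K},$$ $$\begin{aligned}H_2(X,Y)&=19+\frac{1}{\|\tilde Y^2\tilde X\|_1}\left(2\|\tilde Y^2\tilde X\|_2+\sigma_X\|\tilde Y\|_4^2+4\sigma_Y\|\tilde X\tilde Y\|_2\right)\\&+\frac{9c_{BE}\|\tilde X\varepsilon\|_3^3}{\|\tilde X\varepsilon\|_2^3}+\frac{6c_{BE}\|\varepsilon\|_3^3}{\sigma_\varepsilon^3}+\frac{16c_{BE}\|\tilde X\|_3^3}{\sigma_X^3}+\frac{2c_{BE}\|\tilde X\varepsilon\|_6^6}{[\mathrm{Var}(\tilde X^2\varepsilon^2)]^{3/2}}+\frac{6c_{BE}\|\tilde Y\|_3^3}{\sigma_Y^3}\\&+4\frac{\|\tilde X^2\tilde Y\|_2}{\|\tilde X^2\tilde Y\|_1}+2\frac{\sigma_Y\|\tilde X\|_4^2}{\|\tilde X^2\tilde Y\|_1}+\frac{13}{2}\frac{\sigma_X\|\tilde X\|_4^2}{\|\tilde X\|_3^3}+9\frac{\|\tilde X\|_6^3}{\|\tilde X\|_3^3}+12\frac{\|\tilde Y\|_4^2}{\sigma_Y^2}+32\frac{\|\tilde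 X\|_4^2}{\sigma_X^2}\\&+2^{11/2}\frac{\|\tilde X^3\tilde Y\|_{3/2}^{3/2}}{\|\tilde X^3\tilde Y\|_1^{3/2}}+\frac34\frac{\sigma_Y\|\tilde X\|_6^3}{\|\tilde X^3\tilde Y\|_1}+16\frac{\|\tilde X\|_6^6}{\|\tilde X\|_4^6}+\frac{\sigma_X\|\tilde X\|_6^3}{\|\tilde X\|_4^4}+\frac{64\|\tilde Y^2\tilde X\|_1\sigma_X}{\|\tilde X\varepsilon\|_2^2}\\&+\frac{1120\|\tilde X\|_3^3\sigma_Y^2}{\|\tilde X\varepsilon\|_2^2\sigma_X}+64\sqrt2\frac{\|\tilde X\varepsilon\|_3^3}{\|\tilde X\varepsilon\|_2^3}+\frac{288\sigma_Y\|\tilde X^2\tilde Y\|_1}{\|\tilde X\varepsilon\|_2^2}+\frac{432|\tau|\|\tilde X\|_3^3\sigma_Y}{\|\tilde X\varepsilon\|_2^2}\\&+\frac{1152\|\tilde X^3\tilde Y\|_1}{\sigma_X^2\|\tilde X\varepsilon\|_2}+\frac{1152\|\tilde X\|_4^4\sigma_Y}{\sigma_X^3\|\tilde X\varepsilon\|_2}+\frac{576|\tau|\|\tilde X\|_4^4}{\sigma_X^2\|\tilde X\varepsilon\|_2}+\frac{576\|\tilde X^2\tilde Y\|_1\sigma_Y}{\|\tilde X\varepsilon\|_2^2\sigma_X},\end{aligned}$$ $$H_3(X,Y)=\frac{288K\sigma_\varepsilon}{\|\tilde X\varepsilon\|_2^2\sigma_X}\left[4\|\tilde X^3\tilde Y\|_1+4\frac{\sigma_Y\|\tilde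 X\|_4^4}{\sigma_X}+|\tau|\|\tilde X\|_4^4\right],$$ $$H_4(X,Y)=8\left[4+\frac{144\|\tilde X^3\tilde Y\|_1\sigma_\varepsilon}{\sigma_X\|\tilde X\varepsilon\|_2^2}+\frac{144\sigma_Y\sigma_\varepsilon\|\tilde X\|_4^4}{\|\tilde X\varepsilon\|_2^2\sigma_X^2}+\frac{72|\tau|\sigma_\varepsilon\|\tilde X\|_4^4}{\sigma_X\|\tilde X\varepsilon\|_2^2}+\frac{c_{1,R}^2\sigma_X^3}{\|\tilde X\|_3^3}+\frac{2c_{1,R}^2\sigma_X\sigma_Y^2}{\|\tilde Y^2\tilde X\|_1}\right],$$ $$H_5(X,Y)=32c_{2,R}^2\left[\frac{\sigma_X\|\tilde X\|_4^2}{\|\tilde X\|_3^3}+\frac{2\sigma_X\|\tilde Y\|_4^2}{\|\tilde Y^2\tilde X\|_1}\right].$$ *)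

theory Defs
  imports "HOL-Probability.Probability"
begin

section \<open>Norms and moments\<close>

definition Lnorm :: "'a measure \<Rightarrow> real \<Rightarrow> ('a \<Rightarrow> real) \<Rightarrow> real" where
  "Lnorm N r Z = (\<integral>\<omega>. \<bar>Z \<omega>\<bar> powr r \<partial>N) powr (1 / r)"

text \<open>The Bochner integral of a non-integrable function is \<open>0\<close>, so finiteness of a norm has to be
  stated separately.\<close>

definition finite_Lnorm :: "'a measure \<Rightarrow> real \<Rightarrow> ('a \<Rightarrow> real) \<Rightarrow> bool" where
  "finite_Lnorm N r Z \<longleftrightarrow>
     Z \<in> borel_measurable N \<and> integrable N (\<lambda>\<omega>. \<bar>Z \<omega>\<bar> powr r)"

definition covariance :: "'a measure \<Rightarrow> ('a \<Rightarrow> real) \<Rightarrow> ('a \<Rightarrow> real) \<Rightarrow> real" where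
  "covariance N X Y = prob_space.expectation N
     (\<lambda>\<omega>. (X \<omega> - prob_space.expectation N X) * (Y \<omega> - prob_space.expectation N Y))"

definition Phi :: "real \<Rightarrow> real" where
  "Phi = cdf std_normal_distribution"


section \<open>The Berry-Esseen and Rosenthal constants\<close>

definition iid_centered :: "'a measure \<Rightarrow> nat \<Rightarrow> (nat \<Rightarrow> 'a \<Rightarrow> real) \<Rightarrow> bool" where
  "iid_centered M n Z \<longleftrightarrow> prob_space M \<and>
     prob_space.indep_vars M (\<lambda>_. borel) Z {1..n} \<and>
     (\<forall>i\<in>{1..n}. distr M borel (Z i) = distr M borel (Z 1)) \<and>
     integrable M (Z 1) \<and> prob_space.expectation M (Z 1) = 0"

text \<open>The two inequalities only involve the joint law of the finite sequence, and every such law is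
  realised by the coordinates of a product measure on \<open>nat \<Rightarrow> real\<close>. Letting the probability space
  range over the measures of this type is therefore the same as letting it range over all
  probability spaces.\<close>

definition berry_esseen_const :: "real \<Rightarrow> bool" where
  "berry_esseen_const c \<longleftrightarrow> 0 < c \<and>
     (\<forall>(M :: (nat \<Rightarrow> real) measure) n Z.
        1 \<le> n \<longrightarrow> iid_centered M n Z \<longrightarrow> finite_Lnorm M 3 (Z 1) \<longrightarrow>
        0 < prob_space.variance M (Z 1) \<longrightarrow>
        (\<forall>x. \<bar>\<P>(\<omega> in M. sqrt (real n) * ((\<Sum>i=1..n. Z i \<omega>) / real n)
                    / sqrt (prob_space.variance M (Z 1)) \<le> x) - Phi x\<bar>
           \<le> c * prob_space.expectation M (\<lambda>\<omega>. \<bar>Z 1 \<omega>\<bar> ^ 3)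
               / (sqrt (prob_space.variance M (Z 1)) ^ 3 * sqrt (real n))))"

definition rosenthal_consts :: "real \<Rightarrow> real \<Rightarrow> bool" where
  "rosenthal_consts c1 c2 \<longleftrightarrow> 0 < c1 \<and> 0 < c2 \<and>
     (\<forall>(M :: (nat \<Rightarrow> real) measure) n Z (r :: real).
        2 \<le> r \<longrightarrow> 1 \<le> n \<longrightarrow> iid_centered M n Z \<longrightarrow> finite_Lnorm M r (Z 1) \<longrightarrow>
        Lnorm M r (\<lambda>\<omega>. (\<Sum>i=1..n. Z i \<omega>) / real n)
          \<le> c1 * sqrt r * sqrt (prob_space.variance M (Z 1) / real n)
            + c2 * r * real n powr (- (r - 1) / r) * Lnorm M r (Z 1))"


section \<open>Quantities attached to a generic couple\<close>

context
  fixes N :: "'a measure" and X Y :: "'a \<Rightarrow> real"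
begin

definition Xc :: "'a \<Rightarrow> real" where
  "Xc = (\<lambda>\<omega>. X \<omega> - prob_space.expectation N X)"

definition Yc :: "'a \<Rightarrow> real" where
  "Yc = (\<lambda>\<omega>. Y \<omega> - prob_space.expectation N Y)"

definition tau :: real where
  "tau = covariance N X Y / prob_space.variance N X"

definition eps :: "'a \<Rightarrow> real" where
  "eps = (\<lambda>\<omega>. Yc \<omega> - tau * Xc \<omega>)"

definition sX :: real where "sX = sqrt (prob_space.variance N X)"
definition sY :: real where "sY = sqrt (prob_space.variance N Y)"
definition sE :: real where "sE = sqrt (prob_space.variance N eps)"

abbreviation XE :: "'a \<Rightarrow> real" where "XE \<equiv> (\<lambda>\<omega>. Xc \<omega> * eps \<omega>)"
abbreviation XY :: "'a \<Rightarrow> real" where "XY \<equiv> (\<lambda>\<omega>. Xc \<omega> * Yc \<omega>)"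
abbreviation X2Y :: "'a \<Rightarrow> real" where "X2Y \<equiv> (\<lambda>\<omega>. Xc \<omega> ^ 2 * Yc \<omega>)"
abbreviation X3Y :: "'a \<Rightarrow> real" where "X3Y \<equiv> (\<lambda>\<omega>. Xc \<omega> ^ 3 * Yc \<omega>)"
abbreviation Y2X :: "'a \<Rightarrow> real" where "Y2X \<equiv> (\<lambda>\<omega>. Yc \<omega> ^ 2 * Xc \<omega>)"

definition varX2E2 :: real where
  "varX2E2 = prob_space.variance N (\<lambda>\<omega>. Xc \<omega> ^ 2 * eps \<omega> ^ 2)"

abbreviation nrm :: "('a \<Rightarrow> real) \<Rightarrow> real \<Rightarrow> real" (\<open>\<parallel>_\<parallel>\<^bsub>_\<^esub>\<close>) where
  "\<parallel>Z\<parallel>\<^bsub>r\<^esub> \<equiv> Lnorm N r Z"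

text \<open>The two terms with \<open>\<bar>\<tau>\<bar>\<close> in the denominator are omitted from the minimum if \<open>\<tau> = 0\<close>.\<close>

definition Kc :: real where
  "Kc = \<parallel>XE\<parallel>\<^bsub>2\<^esub> / 4 * Min (
     { \<parallel>XE\<parallel>\<^bsub>2\<^esub> / (36 * \<parallel>X2Y\<parallel>\<^bsub>1\<^esub> * sY),
       \<parallel>XE\<parallel>\<^bsub>2\<^esub> * sX / (72 * \<parallel>X2Y\<parallel>\<^bsub>1\<^esub> * sY),
       \<parallel>XE\<parallel>\<^bsub>2\<^esub> * sX / (72 * \<parallel>Xc\<parallel>\<^bsub>3\<^esub> ^ 3 * sY ^ 2),
       sX ^ 2 / (288 * \<parallel>X3Y\<parallel>\<^bsub>1\<^esub>),
       sX ^ 3 / (288 * \<parallel>Xc\<parallel>\<^bsub>4\<^esub> ^ 4 * sY),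
       \<parallel>XE\<parallel>\<^bsub>2\<^esub> / \<parallel>XE\<parallel>\<^bsub>4\<^esub> ^ 2,
       \<parallel>XE\<parallel>\<^bsub>2\<^esub> / (8 * \<parallel>Y2X\<parallel>\<^bsub>1\<^esub> * sX) }
     \<union> (if tau = 0 then {} else
     { \<parallel>XE\<parallel>\<^bsub>2\<^esub> / (36 * \<bar>tau\<bar> * \<parallel>Xc\<parallel>\<^bsub>3\<^esub> ^ 3 * sY),
       sX ^ 2 / (72 * \<bar>tau\<bar> * \<parallel>Xc\<parallel>\<^bsub>4\<^esub> ^ 4) }))"

definition H1 :: real where
  "H1 = 3 * sE * sX / (sqrt (2 * pi) * \<parallel>XE\<parallel>\<^bsub>2\<^esub>) + 1 / (sqrt (2 * pi) * Kc)"

definition H2 :: "real \<Rightarrow> real" where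
  "H2 cBE =
     19 + 1 / \<parallel>Y2X\<parallel>\<^bsub>1\<^esub> * (2 * \<parallel>Y2X\<parallel>\<^bsub>2\<^esub> + sX * \<parallel>Yc\<parallel>\<^bsub>4\<^esub> ^ 2 + 4 * sY * \<parallel>XY\<parallel>\<^bsub>2\<^esub>)
     + 9 * cBE * \<parallel>XE\<parallel>\<^bsub>3\<^esub> ^ 3 / \<parallel>XE\<parallel>\<^bsub>2\<^esub> ^ 3
     + 6 * cBE * \<parallel>eps\<parallel>\<^bsub>3\<^esub> ^ 3 / sE ^ 3
     + 16 * cBE * \<parallel>Xc\<parallel>\<^bsub>3\<^esub> ^ 3 / sX ^ 3
     + 2 * cBE * \<parallel>XE\<parallel>\<^bsub>6\<^esub> ^ 6 / varX2E2 powr (3 / 2)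
     + 6 * cBE * \<parallel>Yc\<parallel>\<^bsub>3\<^esub> ^ 3 / sY ^ 3
     + 4 * (\<parallel>X2Y\<parallel>\<^bsub>2\<^esub> / \<parallel>X2Y\<parallel>\<^bsub>1\<^esub>)
     + 2 * (sY * \<parallel>Xc\<parallel>\<^bsub>4\<^esub> ^ 2 / \<parallel>X2Y\<parallel>\<^bsub>1\<^esub>)
     + 13 / 2 * (sX * \<parallel>Xc\<parallel>\<^bsub>4\<^esub> ^ 2 / \<parallel>Xc\<parallel>\<^bsub>3\<^esub> ^ 3)
     + 9 * (\<parallel>Xc\<parallel>\<^bsub>6\<^esub> ^ 3 / \<parallel>Xc\<parallel>\<^bsub>3\<^esub> ^ 3)
     + 12 * (\<parallel>Yc\<parallel>\<^bsub>4\<^esub> ^ 2 / sY ^ 2)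
     + 32 * (\<parallel>Xc\<parallel>\<^bsub>4\<^esub> ^ 2 / sX ^ 2)
     + 2 powr (11 / 2) * (\<parallel>X3Y\<parallel>\<^bsub>3/2\<^esub> powr (3 / 2) / \<parallel>X3Y\<parallel>\<^bsub>1\<^esub> powr (3 / 2))
     + 3 / 4 * (sY * \<parallel>Xc\<parallel>\<^bsub>6\<^esub> ^ 3 / \<parallel>X3Y\<parallel>\<^bsub>1\<^esub>)
     + 16 * (\<parallel>Xc\<parallel>\<^bsub>6\<^esub> ^ 6 / \<parallel>Xc\<parallel>\<^bsub>4\<^esub> ^ 6)
     + sX * \<parallel>Xc\<parallel>\<^bsub>6\<^esub> ^ 3 / \<parallel>Xc\<parallel>\<^bsub>4\<^esub> ^ 4
     + 64 * \<parallel>Y2X\<parallel>\<^bsub>1\<^esub> * sX / \<parallel>XE\<parallel>\<^bsub>2\<^esub> ^ 2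
     + 1120 * \<parallel>Xc\<parallel>\<^bsub>3\<^esub> ^ 3 * sY ^ 2 / (\<parallel>XE\<parallel>\<^bsub>2\<^esub> ^ 2 * sX)
     + 64 * sqrt 2 * (\<parallel>XE\<parallel>\<^bsub>3\<^esub> ^ 3 / \<parallel>XE\<parallel>\<^bsub>2\<^esub> ^ 3)
     + 288 * sY * \<parallel>X2Y\<parallel>\<^bsub>1\<^esub> / \<parallel>XE\<parallel>\<^bsub>2\<^esub> ^ 2
     + 432 * \<bar>tau\<bar> * \<parallel>Xc\<parallel>\<^bsub>3\<^esub> ^ 3 * sY / \<parallel>XE\<parallel>\<^bsub>2\<^esub> ^ 2
     + 1152 * \<parallel>X3Y\<parallel>\<^bsub>1\<^esub> / (sX ^ 2 * \<parallel>XE\<parallel>\<^bsub>2\<^esub>)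
     + 1152 * \<parallel>Xc\<parallel>\<^bsub>4\<^esub> ^ 4 * sY / (sX ^ 3 * \<parallel>XE\<parallel>\<^bsub>2\<^esub>)
     + 576 * \<bar>tau\<bar> * \<parallel>Xc\<parallel>\<^bsub>4\<^esub> ^ 4 / (sX ^ 2 * \<parallel>XE\<parallel>\<^bsub>2\<^esub>)
     + 576 * \<parallel>X2Y\<parallel>\<^bsub>1\<^esub> * sY / (\<parallel>XE\<parallel>\<^bsub>2\<^esub> ^ 2 * sX)"

definition H3 :: real where
  "H3 = 288 * Kc * sE / (\<parallel>XE\<parallel>\<^bsub>2\<^esub> ^ 2 * sX)
     * (4 * \<parallel>X3Y\<parallel>\<^bsub>1\<^esub> + 4 * (sY * \<parallel>Xc\<parallel>\<^bsub>4\<^esub> ^ 4 / sX) + \<bar>tau\<bar> * \<parallel>Xc\<parallel>\<^bsub>4\<^esub> ^ 4)"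

definition H4 :: "real \<Rightarrow> real" where
  "H4 c1R = 8 * (4
     + 144 * \<parallel>X3Y\<parallel>\<^bsub>1\<^esub> * sE / (sX * \<parallel>XE\<parallel>\<^bsub>2\<^esub> ^ 2)
     + 144 * sY * sE * \<parallel>Xc\<parallel>\<^bsub>4\<^esub> ^ 4 / (\<parallel>XE\<parallel>\<^bsub>2\<^esub> ^ 2 * sX ^ 2)
     + 72 * \<bar>tau\<bar> * sE * \<parallel>Xc\<parallel>\<^bsub>4\<^esub> ^ 4 / (sX * \<parallel>XE\<parallel>\<^bsub>2\<^esub> ^ 2)
     + c1R ^ 2 * sX ^ 3 / \<parallel>Xc\<parallel>\<^bsub>3\<^esub> ^ 3
     + 2 * c1R ^ 2 * sX * sY ^ 2 / \<parallel>Y2X\<parallel>\<^bsub>1\<^esub>)"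

definition H5 :: "real \<Rightarrow> real" where
  "H5 c2R = 32 * c2R ^ 2 * (sX * \<parallel>Xc\<parallel>\<^bsub>4\<^esub> ^ 2 / \<parallel>Xc\<parallel>\<^bsub>3\<^esub> ^ 3
     + 2 * sX * \<parallel>Yc\<parallel>\<^bsub>4\<^esub> ^ 2 / \<parallel>Y2X\<parallel>\<^bsub>1\<^esub>)"

text \<open>All norms occurring in \<open>Kc\<close>, \<open>H1\<close>, ..., \<open>H5\<close>. The standard deviations are finite for
  square integrable couples, and \<open>varX2E2\<close> is finite as soon as \<open>\<parallel>XE\<parallel>\<^bsub>4\<^esub>\<close> is.\<close>

definition norms_finite :: bool where
  "norms_finite \<longleftrightarrow>
     finite_Lnorm N 3 Xc \<and> finite_Lnorm N 4 Xc \<and> finite_Lnorm N 6 Xc \<and>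
     finite_Lnorm N 3 Yc \<and> finite_Lnorm N 4 Yc \<and>
     finite_Lnorm N 3 eps \<and>
     finite_Lnorm N 2 XE \<and> finite_Lnorm N 3 XE \<and> finite_Lnorm N 4 XE \<and> finite_Lnorm N 6 XE \<and>
     finite_Lnorm N 2 XY \<and>
     finite_Lnorm N 1 X2Y \<and> finite_Lnorm N 2 X2Y \<and>
     finite_Lnorm N 1 Y2X \<and> finite_Lnorm N 2 Y2X \<and>
     finite_Lnorm N 1 X3Y \<and> finite_Lnorm N (3 / 2) X3Y"

text \<open>Every denominator, except those with a factor \<open>\<bar>\<tau>\<bar>\<close> (which are dropped when \<open>\<tau> = 0\<close>), is a
  positive constant times a product of positive powers of the following quantities.\<close>

definition denominators_nonzero :: bool where
  "denominators_nonzero \<longleftrightarrow>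
     sX \<noteq> 0 \<and> sY \<noteq> 0 \<and> sE \<noteq> 0 \<and> varX2E2 \<noteq> 0 \<and> Kc \<noteq> 0 \<and>
     \<parallel>Xc\<parallel>\<^bsub>3\<^esub> \<noteq> 0 \<and> \<parallel>Xc\<parallel>\<^bsub>4\<^esub> \<noteq> 0 \<and>
     \<parallel>XE\<parallel>\<^bsub>2\<^esub> \<noteq> 0 \<and> \<parallel>XE\<parallel>\<^bsub>4\<^esub> \<noteq> 0 \<and>
     \<parallel>X2Y\<parallel>\<^bsub>1\<^esub> \<noteq> 0 \<and> \<parallel>Y2X\<parallel>\<^bsub>1\<^esub> \<noteq> 0 \<and> \<parallel>X3Y\<parallel>\<^bsub>1\<^esub> \<noteq> 0"

end


section \<open>The sample\<close>

text \<open>The random vector \<open>(Y, X\<^sup>1, \<dots>, X\<^sup>p)\<close> as a random variable with values in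
  \<open>\<real> \<times> \<real>\<^sup>p\<close>.\<close>

definition obs_space :: "nat \<Rightarrow> (real \<times> (nat \<Rightarrow> real)) measure" where
  "obs_space p = borel \<Otimes>\<^sub>M (\<Pi>\<^sub>M j\<in>{1..p}. borel)"

definition obs ::
  "nat \<Rightarrow> ('a \<Rightarrow> real) \<Rightarrow> (nat \<Rightarrow> 'a \<Rightarrow> real) \<Rightarrow> 'a \<Rightarrow> real \<times> (nat \<Rightarrow> real)" where
  "obs p Y X = (\<lambda>\<omega>. (Y \<omega>, \<lambda>j\<in>{1..p}. X j \<omega>))"

text \<open>A quotient that takes the fixed value \<open>d\<close> when the denominator vanishes.\<close>

definition ratio :: "real \<Rightarrow> real \<Rightarrow> real \<Rightarrow> real" where
  "ratio d a b = (if b = 0 then d else a / b)"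

definition mean :: "nat \<Rightarrow> (nat \<Rightarrow> real) \<Rightarrow> real" where
  "mean n x = (\<Sum>i=1..n. x i) / real n"

text \<open>In the following \<open>x i\<close> and \<open>y i\<close>, for \<open>i \<in> {1..n}\<close>, are the observed values of one covariate
  and of the response; \<open>d\<^sub>1\<close>, \<open>d\<^sub>2\<close>, \<open>d\<^sub>3\<close> are the default values of the slope estimator, of the
  variance estimator and of the test statistic.\<close>

definition tau_hat :: "real \<Rightarrow> nat \<Rightarrow> (nat \<Rightarrow> real) \<Rightarrow> (nat \<Rightarrow> real) \<Rightarrow> real" where
  "tau_hat d\<^sub>1 n x y = ratio d\<^sub>1
     (\<Sum>i=1..n. (x i - mean n x) * (y i - mean n y)) (\<Sum>i=1..n. (x i - mean n x) ^ 2)"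

definition b_hat :: "real \<Rightarrow> nat \<Rightarrow> (nat \<Rightarrow> real) \<Rightarrow> (nat \<Rightarrow> real) \<Rightarrow> real" where
  "b_hat d\<^sub>1 n x y = mean n y - tau_hat d\<^sub>1 n x y * mean n x"

definition eps_hat :: "real \<Rightarrow> nat \<Rightarrow> (nat \<Rightarrow> real) \<Rightarrow> (nat \<Rightarrow> real) \<Rightarrow> nat \<Rightarrow> real" where
  "eps_hat d\<^sub>1 n x y i = y i - b_hat d\<^sub>1 n x y - tau_hat d\<^sub>1 n x y * x i"

definition v_hat :: "real \<Rightarrow> real \<Rightarrow> nat \<Rightarrow> (nat \<Rightarrow> real) \<Rightarrow> (nat \<Rightarrow> real) \<Rightarrow> real" where
  "v_hat d\<^sub>1 d\<^sub>2 n x y = ratio d\<^sub>2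
     (1 / real n * (\<Sum>i=1..n. (x i - mean n x) ^ 2 * eps_hat d\<^sub>1 n x y i ^ 2))
     ((1 / real n * (\<Sum>i=1..n. (x i - mean n x) ^ 2)) ^ 2)"

definition test_stat ::
  "real \<Rightarrow> real \<Rightarrow> real \<Rightarrow> nat \<Rightarrow> (nat \<Rightarrow> real) \<Rightarrow> (nat \<Rightarrow> real) \<Rightarrow> real" where
  "test_stat d\<^sub>1 d\<^sub>2 d\<^sub>3 n x y =
     ratio d\<^sub>3 (sqrt (real n) * \<bar>tau_hat d\<^sub>1 n x y\<bar>) (sqrt (v_hat d\<^sub>1 d\<^sub>2 n x y))"

end

theory Submission
  imports Defs
begin

text \<open>
  If \<open>\<tau> = 0\<close> the residual \<open>\<epsilon>\<close> is the centred response, and the test statistic is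
  \<open>\<surd>n \<bar>S\<bar> / Q\<close>, where \<open>S\<close> is the mean of \<open>xy\<close> minus the product of the two means and \<open>Q\<close> is the
  empirical \<open>L\<^sup>2\<close>-norm of the products of centred covariates and residuals. By Minkowski's
  inequality in this empirical norm, \<open>Q\<close> differs from \<open>a = \<parallel>XY\<parallel>\<^sub>2\<close> by at most \<open>0.3 k r a\<close> with
  \<open>k = 1 / K\<close> and \<open>r = \<surd>(log n / n)\<close>, outside an event whose probability is \<open>O(1 / \<surd>n)\<close> by the
  Berry-Esseen inequality for \<open>X\<close>, \<open>Y\<close>, \<open>XY\<close>, \<open>X\<^sup>2Y\<^sup>2\<close> and Chebyshev's inequality. Hence the
  rejection probability lies between two-sided probabilities for the mean of \<open>XY\<close> at slightly
  perturbed thresholds, and these are Gaussian up to a Berry-Esseen error. Only \<open>H\<^sub>1\<close> and \<open>H\<^sub>2\<close> are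
  needed to absorb the errors, because the claim is trivial when its right-hand side is at least \<open>1\<close>.
\<close>

section \<open>The standard Gaussian distribution function\<close>

text \<open>The threshold \<gamma> is unbounded as the nominal level tends to 0, so an error in the
  normaliser \<open>Q\<close> must cost an amount free of \<gamma>. A factor 1 + \<delta> on the
  threshold is charged through the boundedness of s times the Gaussian density at s, an additive
  shift through the supremum of the density. The delicate error comes from the estimated slope. In
  the empirical norm it has relative size r times the ratio of \<open>Lnorm N 4 (Xc N X) ^ 2\<close>
  to \<open>sX N X ^ 2\<close>, and this ratio is not itself a term of K. It is dominated by k after
  two terms of K are multiplied and the L2 norm of XY is interpolated between L1, where
  Cauchy-Schwarz applies, and L4. Every smallness condition comes from the non-trivial regime. If
  twice the sum of the relevant terms is below 1, then sqrt n exceeds 38, k log n / sqrt n is at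
  most 3/2, and the fourth-moment ratios of X and Y are small multiples of sqrt n. The last fact
  also converts the squared ratios that Chebyshev's inequality produces into the first powers
  occurring in \<open>H2\<close>.\<close>

lemma std_normal_density_eq: "std_normal_density s = exp (- (s\<^sup>2 / 2)) / sqrt (2 * pi)"
  by (simp add: std_normal_density_def)

lemma measure_std_normal_distribution:
  assumes [measurable]: "A \<in> sets borel"
  shows "measure std_normal_distribution A = (\<integral>s. indicator A s * std_normal_density s \<partial>lborel)"
proof -
  have "measure std_normal_distribution A = (\<integral>s. indicator A s \<partial>std_normal_distribution)"
    by simp
  also have "\<dots> = (\<integral>s. indicator A s * std_normal_density s \<partial>lborel)"
    by (subst integral_real_density) (auto simp: mult.commute)
  finally show ?thesis .
qed

lemma Phi_diff: "a \<le> b \<Longrightarrow> Phi b - Phi a = measure std_normal_distribution {a<..b}"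
proof -
  interpret real_distribution std_normal_distribution by (rule real_dist_normal_dist)
  assume "a \<le> b"
  then show ?thesis
    by (cases "a = b") (auto simp: Phi_def cdf_diff_eq)
qed

lemma Phi_mono: "a \<le> b \<Longrightarrow> Phi a \<le> Phi b"
  using Phi_diff[of a b] measure_nonneg[of std_normal_distribution "{a<..b}"] by linarith

lemma Phi_diff_le:
  assumes "a \<le> b" and C: "\<And>s. a < s \<Longrightarrow> s \<le> b \<Longrightarrow> std_normal_density s \<le> C"
  shows "Phi b - Phi a \<le> C * (b - a)"
proof -
  have int: "integrable lborel (\<lambda>s. indicator {a<..b} s * std_normal_density s)"
    using integrable_real_mult_indicator[of "{a<..b}" lborel std_normal_density]
    by (simp add: mult.commute)
  have "Phi b - Phi a = (\<integral>s. indicator {a<..b} s * std_normal_density s \<partial>lborel)"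
    using assms by (simp add: Phi_diff measure_std_normal_distribution)
  also have "\<dots> \<le> (\<integral>s. C * indicator {a<..b} s \<partial>lborel)"
    using C by (intro integral_mono int integrable_mult_right)
      (auto simp: integrable_indicator_iff assms(1) split: split_indicator)
  also have "\<dots> = C * (b - a)"
    using assms by simp
  finally show ?thesis .
qed

lemma Phi_lipschitz: "a \<le> b \<Longrightarrow> Phi b - Phi a \<le> (b - a) / sqrt (2 * pi)"
  using Phi_diff_le[of a b "1 / sqrt (2 * pi)"]
  by (simp add: std_normal_density_eq divide_right_mono)

text \<open>Since s \<le> 1 + s^2 / 2 \<le> exp (s^2 / 2), the product of s and the density is at
  most 1 / sqrt (2 pi). Rescaling a threshold therefore costs its relative change only, however
  large the threshold is.\<close>

lemma Phi_dilation:
  assumes "0 < a" "a \<le> b"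
  shows "Phi b - Phi a \<le> (b - a) / a / sqrt (2 * pi)"
proof -
  have *: "std_normal_density s \<le> 1 / a / sqrt (2 * pi)" if "a < s" for s
  proof -
    have "a \<le> s" "0 < s" using that assms by auto
    have "0 \<le> (1 - s)\<^sup>2" by simp
    then have "s \<le> 1 + s\<^sup>2 / 2" by (simp add: power2_eq_square algebra_simps)
    also have "\<dots> \<le> exp (s\<^sup>2 / 2)" by (rule exp_ge_add_one_self)
    finally have "a \<le> exp (s\<^sup>2 / 2)" using \<open>a \<le> s\<close> by simp
    then have "exp (- (s\<^sup>2 / 2)) \<le> 1 / a"
      using assms by (simp add: exp_minus inverse_eq_divide frac_le)
    then show ?thesis
      by (simp add: std_normal_density_eq divide_right_mono del: divide_divide_eq_left)
  qed
  show ?thesis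
    using Phi_diff_le[OF assms(2) *] by (simp add: field_simps)
qed

text \<open>The Gaussian law has no atoms. Continuity serves twice: for the intermediate value
  theorem behind the quantile, and for passing from closed to open half-lines in the Berry-Esseen
  bound.\<close>

lemma isCont_Phi: "isCont Phi x"
proof -
  interpret real_distribution std_normal_distribution by (rule real_dist_normal_dist)
  have "measure std_normal_distribution {x} = (\<integral>s. indicator {x} s * std_normal_density s \<partial>lborel)"
    by (rule measure_std_normal_distribution) auto
  also have "\<dots> = (\<integral>s. 0 \<partial>(lborel :: real measure))"
    by (intro integral_cong_AE) (use AE_lborel_singleton[of x] in auto)
  finally show ?thesis
    by (simp add: Phi_def isCont_cdf)
qed

lemma Phi_minus: "Phi (- x) = 1 - Phi x"
proof -
  interpret real_distribution std_normal_distribution by (rule real_dist_normal_dist)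
  have "Phi (- x) = (\<integral>s. indicator {..- x} s * std_normal_density s \<partial>lborel)"
    by (simp add: Phi_def cdf_def measure_std_normal_distribution)
  also have "\<dots> = (\<integral>s. indicator {..- x} (- s) * std_normal_density (- s) \<partial>lborel)"
    using lborel_integral_real_affine[of "-1" "\<lambda>s. indicator {..- x} s * std_normal_density s" 0]
    by simp
  also have "\<dots> = (\<integral>s. indicator {x..} s * std_normal_density s \<partial>lborel)"
    by (intro Bochner_Integration.integral_cong) (auto simp: indicator_def std_normal_density_eq)
  also have "\<dots> = (\<integral>s. std_normal_density s - indicator {..x} s * std_normal_density s \<partial>lborel)"
    by (intro integral_cong_AE) (use AE_lborel_singleton[of x] in \<open>auto simp: indicator_def\<close>)
  also have "\<dots> = 1 - (\<integral>s. indicator {..x} s * std_normal_density s \<partial>lborel)"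
    by (subst Bochner_Integration.integral_diff)
       (auto simp: mult.commute intro!: integrable_real_mult_indicator)
  also have "\<dots> = 1 - Phi x"
    by (simp add: Phi_def cdf_def measure_std_normal_distribution)
  finally show ?thesis .
qed

text \<open>Completing the square: for s \<le> -t the density at s is at most exp (- t^2 / 2) times
  the density of the Gaussian centred at -t, whose total mass is 1.\<close>

lemma Phi_tail:
  assumes "0 \<le> t"
  shows "Phi (- t) \<le> exp (- (t\<^sup>2 / 2))"
proof -
  have "Phi (- t) = (\<integral>s. indicator {..- t} s * std_normal_density s \<partial>lborel)"
    by (simp add: Phi_def cdf_def measure_std_normal_distribution)
  also have "\<dots> \<le> (\<integral>s. exp (- (t\<^sup>2 / 2)) * normal_density (- t) 1 s \<partial>lborel)"
  proof (intro integral_mono)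
    fix s :: real
    show "indicator {..- t} s * std_normal_density s \<le> exp (- (t\<^sup>2 / 2)) * normal_density (- t) 1 s"
    proof (cases "s \<le> - t")
      case True
      then have "t * (t + s) \<le> 0"
        using assms by (simp add: mult_nonneg_nonpos)
      then have "- (s\<^sup>2 / 2) \<le> - (t\<^sup>2 / 2) + - ((s + t)\<^sup>2 / 2)"
        by (simp add: power2_eq_square field_simps)
      then have "exp (- (s\<^sup>2 / 2)) \<le> exp (- (t\<^sup>2 / 2)) * exp (- ((s + t)\<^sup>2 / 2))"
        by (simp flip: exp_add)
      then show ?thesis
        using True by (simp add: normal_density_def divide_right_mono)
    qed (simp add: normal_density_nonneg)
  qed (auto simp: mult.commute intro!: integrable_real_mult_indicator integrable_mult_left)
  also have "\<dots> = exp (- (t\<^sup>2 / 2))"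
    by simp
  finally show ?thesis .
qed

lemma Phi_0: "Phi 0 = 1 / 2"
  using Phi_minus[of 0] by simp

lemma Phi_surj:
  assumes "0 < u" "u < 1"
  shows "\<exists>x. Phi x = u"
proof -
  interpret real_distribution std_normal_distribution by (rule real_dist_normal_dist)
  have "eventually (\<lambda>x. Phi x < u) at_bot"
    using order_tendstoD(2)[OF cdf_lim_at_bot assms(1)] by (simp add: Phi_def)
  then obtain a where a: "Phi a < u"
    using eventually_happens trivial_limit_at_bot_linorder by blast
  have "eventually (\<lambda>x. u < Phi x) at_top"
    using order_tendstoD(1)[OF cdf_lim_at_top_prob assms(2)] by (simp add: Phi_def)
  then obtain b where b: "u < Phi b"
    using eventually_happens trivial_limit_at_top_linorder by blast
  have "a \<le> b"
    using a b Phi_mono[of b a] by linarith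
  then show ?thesis
    using IVT[of Phi a u b] a b isCont_Phi by auto
qed

text \<open>\<open>inv\<close> is a choice of preimage, so the point to secure is that 1 - q / 2 is
  a value of \<open>Phi\<close>; both conclusions hold at any preimage.\<close>

lemma inv_Phi_level:
  assumes "0 < q" "q < 1" "\<gamma> = inv Phi (1 - q / 2)"
  shows "0 < \<gamma>" "2 * Phi (- \<gamma>) = q"
proof -
  have "1 - q / 2 \<in> range Phi"
    using Phi_surj[of "1 - q / 2"] assms(1,2) by (simp add: image_iff eq_commute)
  then have *: "Phi \<gamma> = 1 - q / 2"
    using assms by (simp add: f_inv_into_f)
  show "0 < \<gamma>"
    using Phi_mono[of \<gamma> 0] * Phi_0 assms by force
  show "2 * Phi (- \<gamma>) = q"
    by (simp add: Phi_minus *)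
qed

section \<open>Means of independent samples\<close>

text \<open>The family of coordinates is the identity map, so its joint law is the product measure,
  which is the criterion for independence. This supplies the canonical samples to which the
  definition of the Berry-Esseen constant refers.\<close>

lemma (in prob_space) indep_vars_PiM_coords:
  assumes "I \<noteq> {}" and \<nu>: "\<And>i. i \<in> I \<Longrightarrow> prob_space (\<nu> i)"
  shows "prob_space.indep_vars (PiM I \<nu>) \<nu> (\<lambda>i x. x i) I"
proof -
  interpret P: prob_space "PiM I \<nu>" by (rule prob_space_PiM) (rule \<nu>)
  have "distr (PiM I \<nu>) (PiM I \<nu>) (\<lambda>x. \<lambda>i\<in>I. x i) = distr (PiM I \<nu>) (PiM I \<nu>) (\<lambda>x. x)"
    by (intro distr_cong) (auto simp: space_PiM PiE_def extensional_def fun_eq_iff)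
  also have "\<dots> = PiM I \<nu>" by (simp add: distr_id2)
  also have "\<dots> = PiM I (\<lambda>i. distr (PiM I \<nu>) (\<nu> i) (\<lambda>x. x i))"
    by (intro PiM_cong refl) (auto simp: distr_PiM_component \<nu>)
  finally show ?thesis
    by (subst P.indep_vars_iff_distr_eq_PiM') (auto simp: assms)
qed

text \<open>\<open>berry_esseen_const\<close> quantifies over measures on sequences, while the
  sample lives on an arbitrary \<open>M\<close>. The product law \<open>P\<close> bridges the two:
  the event has the same probability under both, and the moments are those of the generic
  \<open>Z0\<close>.\<close>

lemma berry_esseen_transfer:
  fixes Z :: "nat \<Rightarrow> 'a \<Rightarrow> real" and Z0 :: "'b \<Rightarrow> real"
  assumes c: "berry_esseen_const c" and "1 \<le> n" and "prob_space M" "prob_space N"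
    and ind: "prob_space.indep_vars M (\<lambda>_. borel) Z {1..n}"
    and dist: "\<And>i. i \<in> {1..n} \<Longrightarrow> distr M borel (Z i) = distr N borel Z0"
    and Z0[measurable]: "Z0 \<in> borel_measurable N" and int3: "integrable N (\<lambda>\<omega>. \<bar>Z0 \<omega>\<bar> ^ 3)"
    and mean0: "(\<integral>\<omega>. Z0 \<omega> \<partial>N) = 0" and "0 < \<sigma>" and var: "(\<integral>\<omega>. Z0 \<omega> ^ 2 \<partial>N) = \<sigma>\<^sup>2"
  shows "\<bar>\<P>(\<omega> in M. sqrt (real n) * ((\<Sum>i=1..n. Z i \<omega>) / real n) / \<sigma> \<le> x) - Phi x\<bar>
    \<le> c * (\<integral>\<omega>. \<bar>Z0 \<omega>\<bar> ^ 3 \<partial>N) / (\<sigma> ^ 3 * sqrt (real n))"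
proof -
  interpret M: prob_space M by fact
  interpret N: prob_space N by fact
  define \<nu> where "\<nu> = distr N borel Z0"
  have sets_\<nu>[measurable_cong, simp]: "sets \<nu> = sets borel" by (simp add: \<nu>_def)
  have ps_\<nu>: "prob_space \<nu>" unfolding \<nu>_def by (rule N.prob_space_distr) simp
  define P where "P = PiM {1..n} (\<lambda>_. \<nu>)"
  have sets_P[measurable_cong]: "sets P = sets (PiM {1..n} (\<lambda>_. borel))"
    unfolding P_def by (intro sets_PiM_cong) auto
  interpret P: prob_space P unfolding P_def by (rule prob_space_PiM) (rule ps_\<nu>)
  have ne: "{1..n} \<noteq> {}" using \<open>1 \<le> n\<close> by simp
  have Zm: "Z i \<in> borel_measurable M" if "i \<in> {1..n}" for i
    using ind that by (auto simp: M.indep_vars_def)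
  \<comment> \<open>Independence with identical marginals says that the product measure is the joint
    law of the sample; this carries the event back to \<open>M\<close> at the end.\<close>
  have P_eq: "P = distr M (PiM {1..n} (\<lambda>_. borel)) (\<lambda>\<omega>. \<lambda>i\<in>{1..n}. Z i \<omega>)"
  proof -
    have "P = PiM {1..n} (\<lambda>i. distr M borel (Z i))"
      unfolding P_def \<nu>_def by (intro PiM_cong refl) (simp add: dist)
    also have "\<dots> = distr M (PiM {1..n} (\<lambda>_. borel)) (\<lambda>\<omega>. \<lambda>i\<in>{1..n}. Z i \<omega>)"
      using M.indep_vars_iff_distr_eq_PiM'[THEN iffD1, OF ne Zm ind] by simp
    finally show ?thesis .
  qed
  have m[measurable]: "(\<lambda>\<omega>. \<lambda>i\<in>{1..n}. Z i \<omega>) \<in> measurable M (PiM {1..n} (\<lambda>_. borel))"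
    by (rule measurable_restrict) (rule Zm)
  have comp: "distr P borel (\<lambda>\<omega>. \<omega> i) = \<nu>" if "i \<in> {1..n}" for i
  proof -
    have "distr P borel (\<lambda>\<omega>. \<omega> i) = distr P \<nu> (\<lambda>\<omega>. \<omega> i)"
      by (intro distr_cong) auto
    also have "\<dots> = \<nu>"
      unfolding P_def using that ps_\<nu> by (subst distr_PiM_component) auto
    finally show ?thesis .
  qed
  have 1: "1 \<in> {1..n}" using \<open>1 \<le> n\<close> by simp
  have cm[measurable]: "(\<lambda>\<omega>. \<omega> i) \<in> borel_measurable P" if "i \<in> {1..n}" for i
    using that by (subst measurable_cong_sets[OF sets_P refl]) (rule measurable_component_singleton)
  have integral1: "(\<integral>\<omega>. f (\<omega> 1) \<partial>P) = (\<integral>\<omega>. f (Z0 \<omega>) \<partial>N)"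
    and integrable1: "integrable P (\<lambda>\<omega>. f (\<omega> 1)) \<longleftrightarrow> integrable N (\<lambda>\<omega>. f (Z0 \<omega>))"
    if [measurable]: "f \<in> borel_measurable borel" for f :: "real \<Rightarrow> real"
  proof -
    have "(\<integral>\<omega>. f (\<omega> 1) \<partial>P) = (\<integral>z. f z \<partial>\<nu>)"
      by (subst comp[OF 1, symmetric], subst integral_distr) (use cm[OF 1] in auto)
    then show "(\<integral>\<omega>. f (\<omega> 1) \<partial>P) = (\<integral>\<omega>. f (Z0 \<omega>) \<partial>N)"
      by (simp add: \<nu>_def integral_distr)
    have "integrable P (\<lambda>\<omega>. f (\<omega> 1)) \<longleftrightarrow> integrable \<nu> f"
      by (subst comp[OF 1, symmetric], subst integrable_distr_eq) (use cm[OF 1] in auto)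
    then show "integrable P (\<lambda>\<omega>. f (\<omega> 1)) \<longleftrightarrow> integrable N (\<lambda>\<omega>. f (Z0 \<omega>))"
      by (simp add: \<nu>_def integrable_distr_eq)
  qed
  have "P.indep_vars (\<lambda>_. \<nu>) (\<lambda>i \<omega>. \<omega> i) {1..n}"
    unfolding P_def by (rule M.indep_vars_PiM_coords[OF ne]) (rule ps_\<nu>)
  then have ind': "P.indep_vars (\<lambda>_. borel) (\<lambda>i \<omega>. \<omega> i) {1..n}"
    by (rule P.indep_vars_compose2[where Y="\<lambda>_ y. y"]) (auto intro!: measurable_ident_sets)
  have intZ: "integrable N Z0"
  proof (rule Bochner_Integration.integrable_bound)
    show "integrable N (\<lambda>\<omega>. 1 + \<bar>Z0 \<omega>\<bar> ^ 3)" using int3 by simp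
    have "\<bar>z\<bar> \<le> 1 + \<bar>z\<bar> ^ 3" for z :: real
      using power_increasing[of 1 3 "\<bar>z\<bar>"] by (cases "\<bar>z\<bar> \<le> 1") (auto simp: add_increasing2)
    then show "AE x in N. norm (Z0 x) \<le> norm (1 + \<bar>Z0 x\<bar> ^ 3)"
      by (intro AE_I2) (simp add: add_nonneg_nonneg)
  qed simp
  have iid: "iid_centered P n (\<lambda>i \<omega>. \<omega> i)"
    unfolding iid_centered_def
    using ind' P.prob_space_axioms comp 1 integrable1[of "\<lambda>z. z"] integral1[of "\<lambda>z. z"] intZ mean0
    by auto
  have powr3: "\<bar>z\<bar> powr 3 = \<bar>z\<bar> ^ 3" for z :: real
    using powr_realpow'[of "\<bar>z\<bar>" 3] by simp
  have fin: "finite_Lnorm P 3 (\<lambda>\<omega>. \<omega> 1)"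
    unfolding finite_Lnorm_def powr3
    using cm[OF 1] integrable1[of "\<lambda>z. \<bar>z\<bar> ^ 3"] int3 by auto
  have mean1: "(\<integral>\<omega>. \<omega> 1 \<partial>P) = 0"
    using integral1[of "\<lambda>z. z"] mean0 by simp
  have var1: "(\<integral>\<omega>. (\<omega> 1)\<^sup>2 \<partial>P) = \<sigma>\<^sup>2"
    using integral1[of "\<lambda>z. z\<^sup>2"] var by simp
  have "\<bar>\<P>(\<omega> in P. sqrt (real n) * ((\<Sum>i=1..n. \<omega> i) / real n)
                    / sqrt (P.variance (\<lambda>\<omega>. \<omega> 1)) \<le> x) - Phi x\<bar>
           \<le> c * P.expectation (\<lambda>\<omega>. \<bar>\<omega> 1\<bar> ^ 3)
               / (sqrt (P.variance (\<lambda>\<omega>. \<omega> 1)) ^ 3 * sqrt (real n))"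
    by (rule c[unfolded berry_esseen_const_def, THEN conjunct2, rule_format, OF \<open>1 \<le> n\<close> iid fin])
       (use mean1 var1 \<open>0 < \<sigma>\<close> in simp)
  moreover have "\<P>(\<omega> in P. sqrt (real n) * ((\<Sum>i=1..n. \<omega> i) / real n) / \<sigma> \<le> x)
     = \<P>(\<omega> in M. sqrt (real n) * ((\<Sum>i=1..n. Z i \<omega>) / real n) / \<sigma> \<le> x)"
    unfolding P_eq
    by (subst measure_distr[OF m]) (auto intro!: arg_cong[of _ _ "measure M"] simp: space_PiM)
  moreover have "P.expectation (\<lambda>\<omega>. \<bar>\<omega> 1\<bar> ^ 3) = (\<integral>\<omega>. \<bar>Z0 \<omega>\<bar> ^ 3 \<partial>N)"
    by (rule integral1) simp
  ultimately show ?thesis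
    using mean1 var1 \<open>0 < \<sigma>\<close> by simp
qed

text \<open>Orthogonality: the summand added in the induction is centred and independent of the
  previous sum, so the cross term has expectation 0.\<close>

lemma (in prob_space) expectation_sum_indep_square:
  fixes h :: "'i \<Rightarrow> 'a \<Rightarrow> real"
  assumes "finite I" "indep_vars (\<lambda>_. borel) h I"
    and "\<And>i. i \<in> I \<Longrightarrow> integrable M (\<lambda>\<omega>. (h i \<omega>)\<^sup>2)" "\<And>i. i \<in> I \<Longrightarrow> expectation (h i) = 0"
  shows "integrable M (\<lambda>\<omega>. (\<Sum>i\<in>I. h i \<omega>)\<^sup>2) \<and>
    expectation (\<lambda>\<omega>. (\<Sum>i\<in>I. h i \<omega>)\<^sup>2) = (\<Sum>i\<in>I. expectation (\<lambda>\<omega>. (h i \<omega>)\<^sup>2))"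
  using assms
proof (induction I rule: finite_induct)
  case (insert i I)
  let ?S = "\<lambda>\<omega>. \<Sum>i\<in>I. h i \<omega>"
  have IH: "integrable M (\<lambda>\<omega>. (?S \<omega>)\<^sup>2)"
      "expectation (\<lambda>\<omega>. (?S \<omega>)\<^sup>2) = (\<Sum>i\<in>I. expectation (\<lambda>\<omega>. (h i \<omega>)\<^sup>2))"
    using insert.IH indep_vars_subset[OF insert.prems(1)] insert.prems by auto
  have m: "h j \<in> borel_measurable M" if "j \<in> insert i I" for j
    using insert.prems(1) that unfolding indep_vars_def by auto
  have int: "integrable M (h i)" "integrable M ?S"
    using insert.prems(2)[of i] IH m by (auto intro!: square_integrable_imp_integrable)
  have ind: "indep_var borel (h i) borel ?S"
    using indep_vars_sum[OF insert.hyps insert.prems(1)] .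
  have prod: "integrable M (\<lambda>\<omega>. h i \<omega> * ?S \<omega>)" "expectation (\<lambda>\<omega>. h i \<omega> * ?S \<omega>) = 0"
    using indep_var_integrable[OF ind int] indep_var_lebesgue_integral[OF ind int] insert.prems(3)
    by auto
  have *: "(\<Sum>j\<in>insert i I. h j \<omega>)\<^sup>2 = (h i \<omega>)\<^sup>2 + 2 * (h i \<omega> * ?S \<omega>) + (?S \<omega>)\<^sup>2" for \<omega>
    using insert.hyps by (simp add: power2_sum algebra_simps)
  show ?case
    unfolding * using prod IH insert.prems(2)[of i] insert.hyps by simp
qed simp

text \<open>\<open>U0\<close> on \<open>N\<close> is the generic observation, \<open>U\<close> the
  sample on \<open>M\<close>; the two spaces are unrelated and only laws are compared. The general
  value type lets the observations be pairs, of which each real Borel function again gives an i.i.d.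
  sequence.\<close>

locale iid_sample =
  fixes M :: "'a measure" and N :: "'b measure" and n :: nat
    and U :: "nat \<Rightarrow> 'a \<Rightarrow> 'c :: topological_space" and U0 :: "'b \<Rightarrow> 'c"
  assumes prob_M: "prob_space M" and prob_N: "prob_space N" and n_pos: "1 \<le> n"
    and indep: "prob_space.indep_vars M (\<lambda>_. borel) U {1..n}"
    and dist: "\<And>i. i \<in> {1..n} \<Longrightarrow> distr M borel (U i) = distr N borel U0"
    and U0[measurable]: "U0 \<in> borel_measurable N"
begin

sublocale M: prob_space M by (rule prob_M)
sublocale N: prob_space N by (rule prob_N)

abbreviation E :: "('c \<Rightarrow> real) \<Rightarrow> real" where "E f \<equiv> (\<integral>\<omega>. f (U0 \<omega>) \<partial>N)"

definition avg :: "('c \<Rightarrow> real) \<Rightarrow> 'a \<Rightarrow> real" where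
  "avg f \<omega> = (\<Sum>i=1..n. f (U i \<omega>)) / real n"

lemma U_measurable: "i \<in> {1..n} \<Longrightarrow> U i \<in> borel_measurable M"
  using indep by (auto simp: M.indep_vars_def)

lemma avg_measurable[measurable]: "f \<in> borel_measurable borel \<Longrightarrow> avg f \<in> borel_measurable M"
  unfolding avg_def by (intro borel_measurable_divide borel_measurable_sum)
    (auto intro: measurable_compose[OF U_measurable])

lemma
  assumes f: "f \<in> borel_measurable borel"
  shows indep_f: "M.indep_vars (\<lambda>_. borel) (\<lambda>i \<omega>. f (U i \<omega>) :: real) {1..n}"
    and dist_f: "i \<in> {1..n} \<Longrightarrow> distr M borel (\<lambda>\<omega>. f (U i \<omega>)) = distr N borel (\<lambda>\<omega>. f (U0 \<omega>))"
proof -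
  show "M.indep_vars (\<lambda>_. borel) (\<lambda>i \<omega>. f (U i \<omega>)) {1..n}"
    using M.indep_vars_compose2[OF indep, of "\<lambda>_. f"] f by simp
  assume i: "i \<in> {1..n}"
  have "distr M borel (\<lambda>\<omega>. f (U i \<omega>)) = distr (distr M borel (U i)) borel f"
    using U_measurable[OF i] f by (simp add: distr_distr comp_def)
  also have "\<dots> = distr N borel (\<lambda>\<omega>. f (U0 \<omega>))"
    using U0 f by (simp add: dist[OF i] distr_distr comp_def)
  finally show "distr M borel (\<lambda>\<omega>. f (U i \<omega>)) = distr N borel (\<lambda>\<omega>. f (U0 \<omega>))" .
qed

lemma
  assumes f[measurable]: "f \<in> borel_measurable borel" and i: "i \<in> {1..n}"
  shows expectation_U: "(\<integral>\<omega>. f (U i \<omega>) \<partial>M) = E f"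
    and integrable_U: "integrable M (\<lambda>\<omega>. f (U i \<omega>)) \<longleftrightarrow> integrable N (\<lambda>\<omega>. f (U0 \<omega>) :: real)"
proof -
  note [measurable] = U_measurable[OF i]
  have "(\<integral>\<omega>. f (U i \<omega>) \<partial>M) = (\<integral>u. f u \<partial>distr M borel (U i))"
    by (simp add: integral_distr)
  also have "\<dots> = E f"
    by (simp add: dist[OF i] integral_distr)
  finally show "(\<integral>\<omega>. f (U i \<omega>) \<partial>M) = E f" .
  have "integrable M (\<lambda>\<omega>. f (U i \<omega>)) \<longleftrightarrow> integrable (distr M borel (U i)) f"
    by (simp add: integrable_distr_eq)
  also have "\<dots> \<longleftrightarrow> integrable N (\<lambda>\<omega>. f (U0 \<omega>))"
    by (simp add: dist[OF i] integrable_distr_eq)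
  finally show "integrable M (\<lambda>\<omega>. f (U i \<omega>)) \<longleftrightarrow> integrable N (\<lambda>\<omega>. f (U0 \<omega>))" .
qed

text \<open>The variance is bounded by the raw second moment, so that for the squares of X and Y the
  result involves plain fourth moments, as in \<open>H2\<close>.\<close>

lemma chebyshev:
  assumes f[measurable]: "f \<in> borel_measurable borel"
    and int2: "integrable N (\<lambda>\<omega>. (f (U0 \<omega>))\<^sup>2)" and t: "0 < t"
  shows "\<P>(\<omega> in M. t \<le> \<bar>avg f \<omega> - E f\<bar>) \<le> E (\<lambda>u. (f u)\<^sup>2) / (real n * t\<^sup>2)"
proof -
  define g where "g u = f u - E f" for u
  have g[measurable]: "g \<in> borel_measurable borel"
    unfolding g_def by measurable
  have int1: "integrable N (\<lambda>\<omega>. f (U0 \<omega>))"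
    by (rule N.square_integrable_imp_integrable[OF _ int2]) simp
  have sq: "(g u)\<^sup>2 = (f u)\<^sup>2 - 2 * E f * f u + (E f)\<^sup>2" for u
    by (simp add: g_def power2_diff)
  have intg: "integrable N (\<lambda>\<omega>. (g (U0 \<omega>))\<^sup>2)"
    unfolding sq using int1 int2 by auto
  have Eg: "E g = 0"
    unfolding g_def using int1 by (simp add: N.prob_space)
  have Eg2: "E (\<lambda>u. (g u)\<^sup>2) \<le> E (\<lambda>u. (f u)\<^sup>2)"
    unfolding sq using int1 int2 by (simp add: N.prob_space power2_eq_square)
  have sum: "integrable M (\<lambda>\<omega>. (\<Sum>i=1..n. g (U i \<omega>))\<^sup>2) \<and>
    M.expectation (\<lambda>\<omega>. (\<Sum>i=1..n. g (U i \<omega>))\<^sup>2)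
      = (\<Sum>i=1..n. M.expectation (\<lambda>\<omega>. (g (U i \<omega>))\<^sup>2))"
    by (rule M.expectation_sum_indep_square)
       (use indep_f[OF g] expectation_U[OF g] integrable_U[of "\<lambda>u. (g u)\<^sup>2"] intg Eg in auto)
  have n: "0 < real n" using n_pos by simp
  have eq: "(\<Sum>i=1..n. g (U i \<omega>)) = real n * (avg f \<omega> - E f)" for \<omega>
    using n by (simp add: g_def avg_def sum_subtractf field_simps)
  have "\<P>(\<omega> in M. t \<le> \<bar>avg f \<omega> - E f\<bar>) = \<P>(\<omega> in M. (real n * t)\<^sup>2 \<le> (\<Sum>i=1..n. g (U i \<omega>))\<^sup>2)"
  proof -
    have "t \<le> \<bar>z\<bar> \<longleftrightarrow> (real n * t)\<^sup>2 \<le> (real n * z)\<^sup>2" for z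
      using n t abs_le_square_iff[of t z] by (simp add: power_mult_distrib)
    then show ?thesis by (simp only: eq)
  qed
  also have "\<dots> \<le> M.expectation (\<lambda>\<omega>. (\<Sum>i=1..n. g (U i \<omega>))\<^sup>2) / (real n * t)\<^sup>2"
    using n t sum by (intro integral_Markov_inequality_measure[where A="{}"]) auto
  also have "\<dots> = real n * E (\<lambda>u. (g u)\<^sup>2) / (real n * t)\<^sup>2"
    using sum expectation_U[of "\<lambda>u. (g u)\<^sup>2"] by simp
  also have "\<dots> \<le> real n * E (\<lambda>u. (f u)\<^sup>2) / (real n * t)\<^sup>2"
    using Eg2 by (intro divide_right_mono mult_left_mono) auto
  also have "\<dots> = E (\<lambda>u. (f u)\<^sup>2) / (real n * t\<^sup>2)"
    using n by (simp add: power2_eq_square)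
  finally show ?thesis .
qed

text \<open>Only the moment of order \<open>3/2\<close> of \<open>g\<^sup>4\<close> is available, so \<open>g\<^sup>4\<close> is truncated at \<open>n\<close> times
  its mean before Chebyshev's inequality is applied.\<close>

lemma fourth_moment_tail:
  assumes g[measurable]: "g \<in> borel_measurable borel"
    and int6: "integrable N (\<lambda>\<omega>. g (U0 \<omega>) ^ 6)"
    and \<kappa>: "E (\<lambda>u. g u ^ 4) = \<kappa>" "0 < \<kappa>"
  shows "\<P>(\<omega> in M. 2 * \<kappa> \<le> avg (\<lambda>u. g u ^ 4) \<omega>)
    \<le> 2 * (E (\<lambda>u. g u ^ 6) / sqrt \<kappa> ^ 3) / sqrt (real n)"
proof -
  \<comment> \<open>Bounding g^2 by b amounts to bounding g^4 by n \<kappa>. Stated for g^2, the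
    truncation gives h^2 \<le> b g^6 and leaves precisely the sixth moment.\<close>
  define b where "b = sqrt (real n * \<kappa>)"
  have n: "0 < real n" using n_pos by simp
  have b: "0 < b" "b\<^sup>2 = real n * \<kappa>" using n \<kappa> by (auto simp: b_def)
  define h where "h u = (if (g u)\<^sup>2 \<le> b then g u ^ 4 else 0)" for u
  have h[measurable]: "h \<in> borel_measurable borel" unfolding h_def by measurable
  have h2: "(h u)\<^sup>2 \<le> b * g u ^ 6" for u
  proof (cases "(g u)\<^sup>2 \<le> b")
    case True
    then have "(g u)\<^sup>2 * g u ^ 6 \<le> b * g u ^ 6" by (intro mult_right_mono) auto
    then show ?thesis using True by (simp add: h_def flip: power_add power_mult)
  qed (use b in \<open>simp add: h_def\<close>)
  have inth2: "integrable N (\<lambda>\<omega>. (h (U0 \<omega>))\<^sup>2)"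
    by (rule Bochner_Integration.integrable_bound[where f="\<lambda>\<omega>. b * g (U0 \<omega>) ^ 6"])
       (use int6 h2 in \<open>auto intro: order_trans[OF _ abs_ge_self]\<close>)
  \<comment> \<open>A non-integrable function has Bochner integral 0, so \<kappa> > 0 forces
    integrability.\<close>
  have int4: "integrable N (\<lambda>\<omega>. g (U0 \<omega>) ^ 4)"
    using \<kappa> not_integrable_integral_eq by force
  have Eh: "E h \<le> \<kappa>"
    unfolding \<kappa>(1)[symmetric]
    by (rule integral_mono[OF N.square_integrable_imp_integrable[OF _ inth2] int4])
       (auto simp: h_def)
  have Eh2: "E (\<lambda>u. (h u)\<^sup>2) \<le> b * E (\<lambda>u. g u ^ 6)"
    using integral_mono[OF inth2 integrable_mult_right[OF int6]] h2 by simp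
  have b3: "b ^ 3 = real n * sqrt (real n) * sqrt \<kappa> ^ 3"
    using n \<kappa>(2) by (simp add: power3_eq_cube b(2)[unfolded power2_eq_square])
       (simp add: b_def real_sqrt_mult)
  \<comment> \<open>Truncation takes effect only where g^6 exceeds b^3, an event that Markov's
    inequality for g^6 controls.\<close>
  have large: "\<P>(\<omega> in M. b ^ 3 \<le> g (U i \<omega>) ^ 6) \<le> E (\<lambda>u. g u ^ 6) / b ^ 3" if i: "i \<in> {1..n}" for i
    using integral_Markov_inequality_measure[of M "\<lambda>\<omega>. g (U i \<omega>) ^ 6" "{}" "b ^ 3"]
      integrable_U[OF _ i, of "\<lambda>u. g u ^ 6"] expectation_U[OF _ i, of "\<lambda>u. g u ^ 6"] int6 b
    by simp
  have Um[measurable]: "i \<in> {1..n} \<Longrightarrow> (\<lambda>\<omega>. g (U i \<omega>)) \<in> borel_measurable M" for i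
    by (rule measurable_compose[OF U_measurable g])
  have sub: "{\<omega> \<in> space M. 2 * \<kappa> \<le> avg (\<lambda>u. g u ^ 4) \<omega>} \<subseteq>
    {\<omega> \<in> space M. \<kappa> \<le> \<bar>avg h \<omega> - E h\<bar>} \<union> (\<Union>i\<in>{1..n}. {\<omega> \<in> space M. b ^ 3 \<le> g (U i \<omega>) ^ 6})"
  proof
    fix \<omega> assume \<omega>: "\<omega> \<in> {\<omega> \<in> space M. 2 * \<kappa> \<le> avg (\<lambda>u. g u ^ 4) \<omega>}"
    show "\<omega> \<in> {\<omega> \<in> space M. \<kappa> \<le> \<bar>avg h \<omega> - E h\<bar>} \<union>
      (\<Union>i\<in>{1..n}. {\<omega> \<in> space M. b ^ 3 \<le> g (U i \<omega>) ^ 6})"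
    proof (cases "\<exists>i\<in>{1..n}. b ^ 3 \<le> g (U i \<omega>) ^ 6")
      case False
      have "h (U i \<omega>) = g (U i \<omega>) ^ 4" if "i \<in> {1..n}" for i
      proof -
        have "(g (U i \<omega>))\<^sup>2 \<le> b"
        proof (rule ccontr)
          assume "\<not> (g (U i \<omega>))\<^sup>2 \<le> b"
          then have "b ^ 3 \<le> ((g (U i \<omega>))\<^sup>2) ^ 3" using b by (intro power_mono) auto
          then show False using False that by (simp flip: power_mult)
        qed
        then show ?thesis by (simp add: h_def)
      qed
      then have "avg h \<omega> = avg (\<lambda>u. g u ^ 4) \<omega>" by (simp add: avg_def)
      then show ?thesis using \<omega> Eh by auto
    qed (use \<omega> in auto)
  qed
  have "\<P>(\<omega> in M. 2 * \<kappa> \<le> avg (\<lambda>u. g u ^ 4) \<omega>) \<le>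
    \<P>(\<omega> in M. \<kappa> \<le> \<bar>avg h \<omega> - E h\<bar>) + M.prob (\<Union>i\<in>{1..n}. {\<omega> \<in> space M. b ^ 3 \<le> g (U i \<omega>) ^ 6})"
    by (rule order_trans[OF M.finite_measure_mono[OF sub] measure_Un_le]) auto
  also have "\<dots> \<le> b * E (\<lambda>u. g u ^ 6) / (real n * \<kappa>\<^sup>2) + (\<Sum>i=1..n. E (\<lambda>u. g u ^ 6) / b ^ 3)"
  proof (rule add_mono)
    have "\<P>(\<omega> in M. \<kappa> \<le> \<bar>avg h \<omega> - E h\<bar>) \<le> E (\<lambda>u. (h u)\<^sup>2) / (real n * \<kappa>\<^sup>2)"
      by (rule chebyshev[OF h inth2 \<kappa>(2)])
    also have "\<dots> \<le> b * E (\<lambda>u. g u ^ 6) / (real n * \<kappa>\<^sup>2)"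
      using Eh2 by (rule divide_right_mono) simp
    finally show "\<P>(\<omega> in M. \<kappa> \<le> \<bar>avg h \<omega> - E h\<bar>) \<le> b * E (\<lambda>u. g u ^ 6) / (real n * \<kappa>\<^sup>2)" .
    have "M.prob (\<Union>i\<in>{1..n}. {\<omega> \<in> space M. b ^ 3 \<le> g (U i \<omega>) ^ 6}) \<le>
      (\<Sum>i=1..n. \<P>(\<omega> in M. b ^ 3 \<le> g (U i \<omega>) ^ 6))"
      by (rule M.finite_measure_subadditive_finite) auto
    also have "\<dots> \<le> (\<Sum>i=1..n. E (\<lambda>u. g u ^ 6) / b ^ 3)"
      by (rule sum_mono) (rule large)
    finally show "M.prob (\<Union>i\<in>{1..n}. {\<omega> \<in> space M. b ^ 3 \<le> g (U i \<omega>) ^ 6}) \<le>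
      (\<Sum>i=1..n. E (\<lambda>u. g u ^ 6) / b ^ 3)" .
  qed
  \<comment> \<open>The contribution of the truncated mean and that of the union bound are the same
    number, whence the factor 2.\<close>
  also have "b * E (\<lambda>u. g u ^ 6) / (real n * \<kappa>\<^sup>2) = E (\<lambda>u. g u ^ 6) / sqrt \<kappa> ^ 3 / sqrt (real n)"
  proof -
    define r s where "r = sqrt (real n)" and "s = sqrt \<kappa>"
    have "0 < r" "0 < s" "real n = r\<^sup>2" "\<kappa> = s\<^sup>2" "b = r * s"
      using n \<kappa>(2) by (auto simp: r_def s_def b_def real_sqrt_mult)
    then show ?thesis
      unfolding r_def[symmetric] s_def[symmetric]
      by (simp add: field_simps power_numeral_reduce)
  qed
  also have "(\<Sum>i=1..n. E (\<lambda>u. g u ^ 6) / b ^ 3) = E (\<lambda>u. g u ^ 6) / sqrt \<kappa> ^ 3 / sqrt (real n)"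
    using n by (simp add: b3 field_simps)
  finally show ?thesis by (simp add: mult.commute)
qed

lemma berry_esseen:
  assumes "berry_esseen_const c" and f[measurable]: "f \<in> borel_measurable borel"
    and "integrable N (\<lambda>\<omega>. \<bar>f (U0 \<omega>)\<bar> ^ 3)" "E f = 0" "0 < \<sigma>" "E (\<lambda>u. (f u)\<^sup>2) = \<sigma>\<^sup>2"
  shows "\<bar>\<P>(\<omega> in M. sqrt (real n) * avg f \<omega> / \<sigma> \<le> x) - Phi x\<bar>
    \<le> c * (E (\<lambda>u. \<bar>f u\<bar> ^ 3) / \<sigma> ^ 3) / sqrt (real n)"
  using berry_esseen_transfer[of c n M N "\<lambda>i \<omega>. f (U i \<omega>)" "\<lambda>\<omega>. f (U0 \<omega>)" \<sigma> x]
    assms n_pos prob_M prob_N indep_f[OF f] dist_f[OF f]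
  by (simp add: avg_def)

text \<open>Approach x from the left: for y < x the event W \<le> y is contained in W < x, and
  continuity of \<open>Phi\<close> keeps the constant \<open>B\<close> unchanged.\<close>

lemma berry_esseen_less:
  assumes BE: "\<And>x. \<bar>\<P>(\<omega> in M. W \<omega> \<le> x) - Phi x\<bar> \<le> B"
    and [measurable]: "W \<in> borel_measurable M"
  shows "\<bar>\<P>(\<omega> in M. W \<omega> < x) - Phi x\<bar> \<le> B"
proof -
  have "\<P>(\<omega> in M. W \<omega> < x) \<le> \<P>(\<omega> in M. W \<omega> \<le> x)"
    by (intro M.finite_measure_mono) auto
  moreover have "Phi x \<le> \<P>(\<omega> in M. W \<omega> < x) + B"
  proof (rule tendsto_le)
    show "((\<lambda>y. Phi y) \<longlongrightarrow> Phi x) (at_left x)"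
      using isCont_Phi[of x] by (auto simp: isCont_def intro: filterlim_mono[OF _ order_refl at_le])
    show "eventually (\<lambda>y. Phi y \<le> \<P>(\<omega> in M. W \<omega> < x) + B) (at_left x)"
      unfolding eventually_at_filter
    proof (intro always_eventually allI impI)
      fix y assume "y \<in> {..<x}"
      then have "\<P>(\<omega> in M. W \<omega> \<le> y) \<le> \<P>(\<omega> in M. W \<omega> < x)"
        by (intro M.finite_measure_mono) auto
      then show "Phi y \<le> \<P>(\<omega> in M. W \<omega> < x) + B"
        using BE[of y] by linarith
    qed
  qed (auto simp: trivial_limit_at_left_real)
  ultimately show ?thesis using BE[of x] by linarith
qed

text \<open>The lower bound needs t > 0 to make the two tails disjoint. The upper bound is a union
  bound without sign condition, which matters because the lowered threshold \<gamma> (1 - \<delta>)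
  - \<eta> may be negative.\<close>

lemma two_sided:
  assumes BE: "\<And>x. \<bar>\<P>(\<omega> in M. W \<omega> \<le> x) - Phi x\<bar> \<le> B"
    and [measurable]: "W \<in> borel_measurable M"
  shows "\<P>(\<omega> in M. t \<le> \<bar>W \<omega>\<bar>) \<le> 2 * Phi (- t) + 2 * B"
    and "0 < t \<Longrightarrow> 2 * Phi (- t) - 2 * B \<le> \<P>(\<omega> in M. t \<le> \<bar>W \<omega>\<bar>)"
proof -
  have ge: "\<P>(\<omega> in M. t \<le> W \<omega>) = 1 - \<P>(\<omega> in M. W \<omega> < t)"
    using M.prob_neg[of "\<lambda>\<omega>. W \<omega> < t"] by (simp add: not_less)
  have l: "\<bar>\<P>(\<omega> in M. W \<omega> < t) - Phi t\<bar> \<le> B"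
    by (rule berry_esseen_less[OF BE]) auto
  have sub: "\<P>(\<omega> in M. t \<le> \<bar>W \<omega>\<bar>) = M.prob ({\<omega> \<in> space M. t \<le> W \<omega>} \<union> {\<omega> \<in> space M. W \<omega> \<le> - t})"
    by (rule arg_cong[where f=M.prob]) auto
  also have "\<dots> \<le> \<P>(\<omega> in M. t \<le> W \<omega>) + \<P>(\<omega> in M. W \<omega> \<le> - t)"
    by (rule measure_Un_le) auto
  finally show "\<P>(\<omega> in M. t \<le> \<bar>W \<omega>\<bar>) \<le> 2 * Phi (- t) + 2 * B"
    using ge l BE[of "- t"] Phi_minus[of t] by linarith
  assume "0 < t"
  then have "M.prob ({\<omega> \<in> space M. t \<le> W \<omega>} \<union> {\<omega> \<in> space M. W \<omega> \<le> - t}) =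
    \<P>(\<omega> in M. t \<le> W \<omega>) + \<P>(\<omega> in M. W \<omega> \<le> - t)"
    by (intro M.finite_measure_Union) auto
  then show "2 * Phi (- t) - 2 * B \<le> \<P>(\<omega> in M. t \<le> \<bar>W \<omega>\<bar>)"
    using sub ge l BE[of "- t"] Phi_minus[of t] by linarith
qed

text \<open>At t = sqrt (ln n) the Gaussian bound exp (- t^2 / 2) equals 1 / sqrt n. A deviation on
  this scale is therefore as unlikely as the Berry-Esseen error is small.\<close>

lemma log_tail:
  assumes "berry_esseen_const c" and f[measurable]: "f \<in> borel_measurable borel"
    and "integrable N (\<lambda>\<omega>. \<bar>f (U0 \<omega>)\<bar> ^ 3)" "E f = 0" "0 < \<sigma>" "E (\<lambda>u. (f u)\<^sup>2) = \<sigma>\<^sup>2"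
  shows "\<P>(\<omega> in M. \<sigma> * (sqrt (ln (real n)) / sqrt (real n)) \<le> \<bar>avg f \<omega>\<bar>)
    \<le> (2 + 2 * c * (E (\<lambda>u. \<bar>f u\<bar> ^ 3) / \<sigma> ^ 3)) / sqrt (real n)"
proof -
  define t where "t = sqrt (ln (real n))"
  have n: "0 < real n" "0 \<le> ln (real n)" using n_pos by auto
  have t: "0 \<le> t" "t\<^sup>2 = ln (real n)" using n by (auto simp: t_def)
  have "exp (- (t\<^sup>2 / 2)) = inverse (sqrt (real n))"
    using n ln_sqrt[of "real n"] by (simp add: t(2) exp_minus flip: ln_sqrt)
  then have "Phi (- t) \<le> 1 / sqrt (real n)"
    using Phi_tail[OF t(1)] by (simp add: inverse_eq_divide)
  moreover have "\<P>(\<omega> in M. \<sigma> * (t / sqrt (real n)) \<le> \<bar>avg f \<omega>\<bar>) =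
    \<P>(\<omega> in M. t \<le> \<bar>sqrt (real n) * avg f \<omega> / \<sigma>\<bar>)"
    using n \<open>0 < \<sigma>\<close> by (simp add: abs_mult field_simps)
  moreover have "\<dots> \<le> 2 * Phi (- t) + 2 * (c * (E (\<lambda>u. \<bar>f u\<bar> ^ 3) / \<sigma> ^ 3) / sqrt (real n))"
    by (rule two_sided(1)[OF berry_esseen[OF assms]]) auto
  ultimately show ?thesis
    by (simp add: t_def add_divide_distrib)
qed

end

section \<open>The test statistic as a function of the sample\<close>

lemma mean_add: "mean n (\<lambda>i. f i + g i) = mean n f + mean n g"
  by (simp add: mean_def sum.distrib add_divide_distrib)

lemma mean_diff: "mean n (\<lambda>i. f i - g i) = mean n f - mean n g"
  by (simp add: mean_def sum_subtractf diff_divide_distrib)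

lemma mean_cmult: "mean n (\<lambda>i. c * f i) = c * mean n f"
  by (simp add: mean_def sum_distrib_left)

lemma mean_const: "1 \<le> n \<Longrightarrow> mean n (\<lambda>i. c) = c"
  by (simp add: mean_def)

lemma mean_nonneg: "(\<And>i. 0 \<le> f i) \<Longrightarrow> 0 \<le> mean n f"
  by (simp add: mean_def sum_nonneg)

definition rms :: "nat \<Rightarrow> (nat \<Rightarrow> real) \<Rightarrow> real" where
  "rms n f = sqrt (mean n (\<lambda>i. (f i)\<^sup>2))"

text \<open>Up to normalisation the empirical norm is \<open>L2_set\<close>, from which it inherits
  Minkowski's inequality.\<close>

lemma rms_L2_set: "rms n f = L2_set f {1..n} / sqrt (real n)"
  by (simp add: rms_def mean_def L2_set_def real_sqrt_divide)

lemma rms_nonneg: "0 \<le> rms n f"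
  by (simp add: rms_def mean_nonneg)

lemma rms_add: "rms n (\<lambda>i. f i + g i) \<le> rms n f + rms n g"
  unfolding rms_L2_set add_divide_distrib[symmetric]
  by (intro divide_right_mono L2_set_triangle_ineq) simp

lemma rms_cmult: "rms n (\<lambda>i. c * f i) = \<bar>c\<bar> * rms n f"
  by (simp add: rms_def power_mult_distrib mean_cmult real_sqrt_mult)

lemma rms_const: "1 \<le> n \<Longrightarrow> rms n (\<lambda>i. c) = \<bar>c\<bar>"
  by (simp add: rms_def mean_const)

lemma rms_uminus: "rms n (\<lambda>i. - f i) = rms n f"
  by (simp add: rms_def)

lemma rms_diff: "rms n (\<lambda>i. f i - g i) \<le> rms n f + rms n g"
  using rms_add[of n f "\<lambda>i. - g i"] by (simp add: rms_uminus)

lemma abs_rms_diff: "\<bar>rms n f - rms n g\<bar> \<le> rms n (\<lambda>i. f i - g i)"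
proof -
  have "rms n f \<le> rms n g + rms n (\<lambda>i. f i - g i)"
    using rms_add[of n g "\<lambda>i. f i - g i"] by simp
  moreover have "rms n g \<le> rms n f + rms n (\<lambda>i. f i - g i)"
    using rms_diff[of n f "\<lambda>i. f i - g i"] by simp
  ultimately show ?thesis by linarith
qed

text \<open>Slope and residuals are built from deviations from sample means, the intercept absorbing
  every shift. Population means may thus be subtracted from the data.\<close>

lemma test_stat_translate:
  assumes "1 \<le> n"
  shows "test_stat d\<^sub>1 d\<^sub>2 d\<^sub>3 n (\<lambda>i. x i + b) (\<lambda>i. y i + c) = test_stat d\<^sub>1 d\<^sub>2 d\<^sub>3 n x y"
proof -
  have m: "mean n (\<lambda>i. f i + b) = mean n f + b" for f b
    using assms by (simp add: mean_add mean_const)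
  have t: "tau_hat d\<^sub>1 n (\<lambda>i. x i + b) (\<lambda>i. y i + c) = tau_hat d\<^sub>1 n x y"
    unfolding tau_hat_def m by simp
  have e: "eps_hat d\<^sub>1 n (\<lambda>i. x i + b) (\<lambda>i. y i + c) i = eps_hat d\<^sub>1 n x y i" for i
    unfolding eps_hat_def b_hat_def m t by (simp add: algebra_simps)
  show ?thesis
    unfolding test_stat_def v_hat_def t e m by simp
qed

text \<open>Slope and standard error carry the same factor 1 / \<open>s2\<close>, which cancels.
  Positivity of \<open>s2\<close> and \<open>R\<close> ensures that the three quotients take their
  genuine values.\<close>

lemma test_stat_eq:
  fixes x y :: "nat \<Rightarrow> real" and n :: nat
  defines "u \<equiv> \<lambda>i. x i - mean n x" and "w \<equiv> \<lambda>i. y i - mean n y"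
  defines "S \<equiv> mean n (\<lambda>i. u i * w i)" and "s2 \<equiv> mean n (\<lambda>i. (u i)\<^sup>2)"
  defines "R \<equiv> rms n (\<lambda>i. u i * (w i - S / s2 * u i))"
  assumes n: "1 \<le> n" and s2: "0 < s2" and R: "0 < R"
  shows "test_stat d\<^sub>1 d\<^sub>2 d\<^sub>3 n x y = sqrt (real n) * \<bar>S\<bar> / R"
proof -
  have n0: "real n > 0" using n by simp
  have sum_eq: "(\<Sum>i=1..n. f i) = real n * mean n f" for f
    using n0 by (simp add: mean_def)
  have tau: "tau_hat d\<^sub>1 n x y = S / s2"
    using s2 n0 unfolding tau_hat_def sum_eq ratio_def S_def s2_def u_def w_def by simp
  have eps: "eps_hat d\<^sub>1 n x y i = w i - S / s2 * u i" for i
    unfolding eps_hat_def b_hat_def tau u_def w_def by (simp add: algebra_simps)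
  have R2: "R\<^sup>2 = mean n (\<lambda>i. (u i)\<^sup>2 * (w i - S / s2 * u i)\<^sup>2)"
    unfolding R_def rms_def by (simp add: mean_nonneg power_mult_distrib)
  have "v_hat d\<^sub>1 d\<^sub>2 n x y = R\<^sup>2 / s2\<^sup>2"
    using s2 n0 unfolding v_hat_def eps sum_eq ratio_def R2 s2_def u_def by simp
  then have "sqrt (v_hat d\<^sub>1 d\<^sub>2 n x y) = R / s2"
    using s2 R by (simp add: real_sqrt_divide)
  then show ?thesis
    using s2 R by (simp add: test_stat_def ratio_def tau abs_divide)
qed

lemma measurable_test_stat:
  assumes x: "\<And>i. i \<in> {1..n} \<Longrightarrow> (\<lambda>\<omega>. x i \<omega>) \<in> borel_measurable M"
    and y: "\<And>i. i \<in> {1..n} \<Longrightarrow> (\<lambda>\<omega>. y i \<omega>) \<in> borel_measurable M"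
  shows "(\<lambda>\<omega>. test_stat d\<^sub>1 d\<^sub>2 d\<^sub>3 n (\<lambda>i. x i \<omega>) (\<lambda>i. y i \<omega>)) \<in> borel_measurable M"
proof -
  have r[measurable]: "(\<lambda>\<omega>. ratio d (f \<omega>) (g \<omega>)) \<in> borel_measurable M"
    if [measurable]: "f \<in> borel_measurable M" "g \<in> borel_measurable M" for d f g
    unfolding ratio_def by measurable
  have m: "(\<lambda>\<omega>. mean n (\<lambda>i. f i \<omega>)) \<in> borel_measurable M"
    if "\<And>i. i \<in> {1..n} \<Longrightarrow> (\<lambda>\<omega>. f i \<omega>) \<in> borel_measurable M" for f :: "nat \<Rightarrow> 'a \<Rightarrow> real"
    unfolding mean_def using that by (intro borel_measurable_divide borel_measurable_sum) auto
  note [measurable] = m[OF x] m[OF y]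
  have t[measurable]: "(\<lambda>\<omega>. tau_hat d\<^sub>1 n (\<lambda>i. x i \<omega>) (\<lambda>i. y i \<omega>)) \<in> borel_measurable M"
    unfolding tau_hat_def using x y by (intro r borel_measurable_sum) auto
  have e: "(\<lambda>\<omega>. eps_hat d\<^sub>1 n (\<lambda>i. x i \<omega>) (\<lambda>i. y i \<omega>) i) \<in> borel_measurable M"
    if "i \<in> {1..n}" for i
    using x[OF that] y[OF that] unfolding eps_hat_def b_hat_def by measurable
  have [measurable]: "(\<lambda>\<omega>. v_hat d\<^sub>1 d\<^sub>2 n (\<lambda>i. x i \<omega>) (\<lambda>i. y i \<omega>)) \<in> borel_measurable M"
    unfolding v_hat_def using x e
    by (intro r borel_measurable_times borel_measurable_power borel_measurable_sum) auto
  show ?thesis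
    unfolding test_stat_def by measurable
qed

text \<open>Deterministic core: \<open>D\<close> is the product of the two sample means, and the
  error of \<open>Q\<close> is budgeted in units of k r a. The fluctuation of the squared products
  costs 1/4, empirical centring 1/400, the estimated slope 1/30; together less than 3/10.\<close>

lemma test_stat_approx:
  fixes x y :: "nat \<Rightarrow> real" and n :: nat and sX sY a q k r L :: real
  assumes n: "1 \<le> n" and pos: "0 < sX" "0 < sY" "0 < a" "0 < q" "0 < k" "0 \<le> r" "r \<le> 1 / 40"
    and kr: "k * r \<le> 3 / 2"
    and k1: "1152 * (sX * sY) \<le> k * a" and k2: "4 * L \<le> k * a\<^sup>2"
    and k3: "67 * q \<le> k * sX\<^sup>2" and q: "sX\<^sup>2 \<le> q"
    and x1: "\<bar>mean n x\<bar> \<le> sX * r" and y1: "\<bar>mean n y\<bar> \<le> sY * r"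
    and xy1: "\<bar>mean n (\<lambda>i. x i * y i)\<bar> \<le> a * r"
    and xy2: "\<bar>mean n (\<lambda>i. (x i * y i)\<^sup>2) - a\<^sup>2\<bar> \<le> L * r"
    and x2: "\<bar>mean n (\<lambda>i. (x i)\<^sup>2) - sX\<^sup>2\<bar> \<le> sX\<^sup>2 / 4"
    and y2: "\<bar>mean n (\<lambda>i. (y i)\<^sup>2) - sY\<^sup>2\<bar> \<le> sY\<^sup>2 / 4"
    and x4: "mean n (\<lambda>i. x i ^ 4) \<le> 2 * q\<^sup>2"
  obtains D Q where
    "test_stat d\<^sub>1 d\<^sub>2 d\<^sub>3 n x y = sqrt (real n) * \<bar>mean n (\<lambda>i. x i * y i) - D\<bar> / Q"
    "\<bar>D\<bar> \<le> r\<^sup>2 * (k * a / 1152)" "\<bar>Q - a\<bar> \<le> 3 / 10 * (k * r) * a" "0 < Q"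
proof -
  define mx my where "mx = mean n x" and "my = mean n y"
  define u w where "u i = x i - mx" and "w i = y i - my" for i
  define S s2 where "S = mean n (\<lambda>i. u i * w i)" and "s2 = mean n (\<lambda>i. (u i)\<^sup>2)"
  define Q where "Q = rms n (\<lambda>i. u i * (w i - S / s2 * u i))"
  have S: "S = mean n (\<lambda>i. x i * y i) - mx * my"
  proof -
    have "S = mean n (\<lambda>i. x i * y i - my * x i - mx * y i + mx * my)"
      unfolding S_def u_def w_def by (simp add: algebra_simps)
    then show ?thesis
      using n by (simp add: mean_add mean_diff mean_cmult mean_const flip: mx_def my_def)
  qed
  have s2: "s2 = mean n (\<lambda>i. (x i)\<^sup>2) - mx\<^sup>2"
  proof -
    have "s2 = mean n (\<lambda>i. (x i)\<^sup>2 - 2 * mx * x i + mx\<^sup>2)"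
      unfolding s2_def u_def by (simp add: power2_diff algebra_simps)
    then show ?thesis
      using n by (simp add: mean_add mean_diff mean_cmult mean_const power2_eq_square flip: mx_def)
  qed
  have sXY: "0 < sX * sY" using pos by simp
  have r2: "r\<^sup>2 \<le> r / 40"
    using mult_left_mono[OF pos(7,6)] by (simp add: power2_eq_square)
  have mx: "\<bar>mx\<bar> \<le> sX * r" and my: "\<bar>my\<bar> \<le> sY * r"
    using x1 y1 by (simp_all add: mx_def my_def)
  have mxy: "\<bar>mx * my\<bar> \<le> sX * sY * r\<^sup>2"
    using mult_mono[OF mx my] pos by (simp add: abs_mult power2_eq_square algebra_simps)
  have mx2: "mx\<^sup>2 \<le> sX\<^sup>2 * r\<^sup>2"
    using power_mono[OF mx, of 2] by (simp add: power_mult_distrib)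
  \<comment> \<open>3/4 - 1/40 exceeds 7/10.\<close>
  have s2_lower: "7 / 10 * sX\<^sup>2 \<le> s2"
  proof -
    have "sX\<^sup>2 * r\<^sup>2 \<le> sX\<^sup>2 * (1 / 40)"
      using r2 pos by (intro mult_left_mono) auto
    then show ?thesis using s2 x2 mx2 by linarith
  qed
  have "0 < sX\<^sup>2" using pos by simp
  then have s2_pos: "0 < s2" using s2_lower by linarith
  \<comment> \<open>(9/8)^2 = 81/64 exceeds 5/4, the largest ratio of the empirical to the true
    second moment.\<close>
  have rx: "rms n x \<le> 9 / 8 * sX"
  proof -
    have "mean n (\<lambda>i. (x i)\<^sup>2) \<le> (9 / 8 * sX)\<^sup>2"
    proof -
      have "(9 / 8 * sX)\<^sup>2 = 81 / 64 * sX\<^sup>2" by (simp add: power_mult_distrib power_divide)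
      then show ?thesis using x2 zero_le_power2[of sX] by linarith
    qed
    then show ?thesis unfolding rms_def using pos by (intro real_le_lsqrt) auto
  qed
  have ry: "rms n y \<le> 9 / 8 * sY"
  proof -
    have "mean n (\<lambda>i. (y i)\<^sup>2) \<le> (9 / 8 * sY)\<^sup>2"
    proof -
      have "(9 / 8 * sY)\<^sup>2 = 81 / 64 * sY\<^sup>2" by (simp add: power_mult_distrib power_divide)
      then show ?thesis using y2 zero_le_power2[of sY] by linarith
    qed
    then show ?thesis unfolding rms_def using pos by (intro real_le_lsqrt) auto
  qed
  \<comment> \<open>71/50 is slightly above sqrt 2.\<close>
  have rx2: "rms n (\<lambda>i. (x i)\<^sup>2) \<le> 71 / 50 * q"
  proof -
    have x4': "mean n (\<lambda>i. ((x i)\<^sup>2)\<^sup>2) \<le> 2 * q\<^sup>2"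
      using x4 by simp
    have "mean n (\<lambda>i. ((x i)\<^sup>2)\<^sup>2) \<le> (71 / 50 * q)\<^sup>2"
    proof -
      have "(71 / 50 * q)\<^sup>2 = 5041 / 2500 * q\<^sup>2" by (simp add: power_mult_distrib power_divide)
      then show ?thesis using x4' zero_le_power2[of q] by linarith
    qed
    then show ?thesis unfolding rms_def using pos by (intro real_le_lsqrt) auto
  qed
  \<comment> \<open>In units of q the three terms of the expanded square contribute 71/50, 9/160 and
    1/1600, thanks to sX^2 \<le> q.\<close>
  have ru2: "rms n (\<lambda>i. (u i)\<^sup>2) \<le> 3 / 2 * q"
  proof -
    have "rms n (\<lambda>i. (u i)\<^sup>2) = rms n (\<lambda>i. ((x i)\<^sup>2 - 2 * mx * x i) + mx\<^sup>2)"
      unfolding u_def by (simp add: power2_diff algebra_simps)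
    also have "\<dots> \<le> rms n (\<lambda>i. (x i)\<^sup>2) + rms n (\<lambda>i. 2 * mx * x i) + rms n (\<lambda>i. mx\<^sup>2)"
      using rms_add[of n "\<lambda>i. (x i)\<^sup>2 - 2 * mx * x i" "\<lambda>i. mx\<^sup>2"]
        rms_diff[of n "\<lambda>i. (x i)\<^sup>2" "\<lambda>i. 2 * mx * x i"] by linarith
    also have "rms n (\<lambda>i. 2 * mx * x i) = 2 * \<bar>mx\<bar> * rms n x"
      by (simp only: rms_cmult abs_mult abs_numeral)
    also have "rms n (\<lambda>i. mx\<^sup>2) = mx\<^sup>2"
      using n by (simp add: rms_const)
    also have "2 * \<bar>mx\<bar> * rms n x \<le> 2 * (sX * r) * (9 / 8 * sX)"
      using mx rx pos by (intro mult_mono) (auto simp: rms_nonneg)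
    also have "\<dots> = 9 / 4 * r * sX\<^sup>2" by (simp add: power2_eq_square)
    also have "\<dots> \<le> 9 / 4 * (1 / 40) * sX\<^sup>2"
      using pos by (intro mult_right_mono) auto
    also have "mx\<^sup>2 \<le> 1 / 1600 * sX\<^sup>2"
    proof -
      have "sX\<^sup>2 * r\<^sup>2 \<le> sX\<^sup>2 * (1 / 40)\<^sup>2"
        using pos by (intro mult_left_mono power_mono) auto
      then show ?thesis using mx2 by (simp add: power2_eq_square)
    qed
    finally show ?thesis using rx2 q pos by linarith
  qed
  \<comment> \<open>A difference of norms is a difference of squares divided by the sum of the
    norms, and this sum is at least a. No square root has to be expanded.\<close>
  have e1: "\<bar>rms n (\<lambda>i. x i * y i) - a\<bar> \<le> 1 / 4 * (k * r * a)"
  proof -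
    let ?m = "rms n (\<lambda>i. x i * y i)"
    have m2: "?m\<^sup>2 = mean n (\<lambda>i. (x i * y i)\<^sup>2)"
      by (simp add: rms_def mean_nonneg)
    have "\<bar>?m - a\<bar> * a \<le> \<bar>?m - a\<bar> * (?m + a)"
      using rms_nonneg[of n] by (intro mult_left_mono) auto
    also have "\<dots> = \<bar>?m\<^sup>2 - a\<^sup>2\<bar>"
      using pos rms_nonneg[of n "\<lambda>i. x i * y i"]
      by (simp add: power2_eq_square square_diff_square_factored abs_mult)
    also have "\<dots> \<le> L * r" using xy2 m2 by simp
    also have "\<dots> \<le> k * a\<^sup>2 / 4 * r" using k2 pos by (intro mult_right_mono) auto
    also have "\<dots> = 1 / 4 * (k * r * a) * a" by (simp add: power2_eq_square)
    finally show ?thesis using pos by simp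
  qed
  \<comment> \<open>Each of the three terms of u w - x y contains a sample mean, so the norm is at
    most 91/40 times sX sY r; \<open>k1\<close> then gives 91 / (40 * 1152) < 1/400.\<close>
  have e2: "\<bar>rms n (\<lambda>i. u i * w i) - rms n (\<lambda>i. x i * y i)\<bar> \<le> 1 / 400 * (k * r * a)"
  proof -
    have "\<bar>rms n (\<lambda>i. u i * w i) - rms n (\<lambda>i. x i * y i)\<bar> \<le> rms n (\<lambda>i. u i * w i - x i * y i)"
      by (rule abs_rms_diff)
    also have "\<dots> = rms n (\<lambda>i. (mx * my - my * x i) - mx * y i)"
      unfolding u_def w_def by (simp add: algebra_simps)
    also have "\<dots> \<le> rms n (\<lambda>i. mx * my) + rms n (\<lambda>i. my * x i) + rms n (\<lambda>i. mx * y i)"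
      using rms_diff[of n "\<lambda>i. mx * my - my * x i" "\<lambda>i. mx * y i"]
        rms_diff[of n "\<lambda>i. mx * my" "\<lambda>i. my * x i"] by linarith
    also have "\<dots> = \<bar>mx * my\<bar> + \<bar>my\<bar> * rms n x + \<bar>mx\<bar> * rms n y"
      using n by (simp add: rms_const rms_cmult abs_mult)
    also have "\<dots> \<le> sX * sY * (r / 40) + (sY * r) * (9 / 8 * sX) + (sX * r) * (9 / 8 * sY)"
    proof (intro add_mono mult_mono my mx rx ry)
      have "sX * sY * r\<^sup>2 \<le> sX * sY * (r / 40)"
        using r2 sXY by (intro mult_left_mono) auto
      then show "\<bar>mx * my\<bar> \<le> sX * sY * (r / 40)" using mxy by linarith
    qed (use pos in \<open>auto simp: rms_nonneg\<close>)
    also have "\<dots> = (91 / 40) * (sX * sY) * r" by (simp add: algebra_simps)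
    also have "\<dots> \<le> 91 / 40 * (k * a / 1152) * r"
      using k1 pos by (intro mult_right_mono mult_left_mono) auto
    also have "\<dots> \<le> 1 / 400 * (k * r * a)"
      using pos by (simp add: mult.commute mult.left_commute)
    finally show ?thesis .
  qed
  \<comment> \<open>The slope S / s2 is of order a r / sX^2 and multiplies u^2, whose empirical norm
    is of order q. \<open>k3\<close> pays for q / sX^2, as 303 / (140 * 67) < 1/30.\<close>
  have e3: "\<bar>Q - rms n (\<lambda>i. u i * w i)\<bar> \<le> 1 / 30 * (k * r * a)"
  proof -
    have S_le: "\<bar>S\<bar> \<le> 101 / 100 * (a * r)"
    proof -
      have "sX * sY * r\<^sup>2 \<le> k * a / 1152 * r\<^sup>2"
        using k1 pos by (intro mult_right_mono) auto
      also have "\<dots> = (k * r) * (a * r) / 1152" by (simp add: power2_eq_square)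
      also have "\<dots> \<le> 3 / 2 * (a * r) / 1152"
        using kr pos by (intro divide_right_mono mult_right_mono) auto
      finally have "sX * sY * r\<^sup>2 \<le> 3 / 2 * (a * r) / 1152" .
      moreover have "0 \<le> a * r" using pos by simp
      ultimately show ?thesis using S xy1 mxy by linarith
    qed
    have "\<bar>Q - rms n (\<lambda>i. u i * w i)\<bar> \<le> rms n (\<lambda>i. u i * (w i - S / s2 * u i) - u i * w i)"
      unfolding Q_def by (rule abs_rms_diff)
    also have "\<dots> = rms n (\<lambda>i. - (S / s2) * (u i)\<^sup>2)"
      by (simp add: algebra_simps power2_eq_square)
    also have "\<dots> = \<bar>S\<bar> / s2 * rms n (\<lambda>i. (u i)\<^sup>2)"
      using s2_pos by (simp only: rms_cmult) (simp add: abs_divide)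
    also have "\<dots> \<le> (101 / 100 * (a * r)) / (7 / 10 * sX\<^sup>2) * (3 / 2 * q)"
      using S_le s2_lower ru2 pos s2_pos by (intro mult_mono frac_le) (auto simp: rms_nonneg)
    also have "\<dots> = 303 / 140 * (a * r) * (q / sX\<^sup>2)"
      by simp
    also have "\<dots> \<le> 303 / 140 * (a * r) * (k / 67)"
      using k3 pos by (intro mult_left_mono) (auto simp: field_simps)
    also have "\<dots> \<le> 1 / 30 * (k * r * a)"
      using pos by (simp add: mult.commute mult.left_commute)
    finally show ?thesis .
  qed
  have Qa: "\<bar>Q - a\<bar> \<le> 3 / 10 * (k * r) * a"
  proof -
    have "0 \<le> k * r * a" using pos by simp
    then show ?thesis using e1 e2 e3 by linarith
  qed
  have "3 / 10 * (k * r) * a \<le> 1 / 2 * a"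
    using kr pos by (intro mult_right_mono) auto
  then have Q: "0 < Q" using Qa pos by linarith
  have T: "test_stat d\<^sub>1 d\<^sub>2 d\<^sub>3 n x y = sqrt (real n) * \<bar>S\<bar> / Q"
    using test_stat_eq[OF n, of x y d\<^sub>1 d\<^sub>2 d\<^sub>3] s2_pos Q
    unfolding S_def s2_def Q_def u_def w_def mx_def my_def by simp
  have D: "\<bar>mx * my\<bar> \<le> r\<^sup>2 * (k * a / 1152)"
  proof -
    have "sX * sY * r\<^sup>2 \<le> k * a / 1152 * r\<^sup>2"
      using k1 pos by (intro mult_right_mono) auto
    then show ?thesis using mxy by (simp add: mult.commute)
  qed
  show ?thesis
    by (rule that[OF _ D Qa Q]) (use T S in simp)
qed

text \<open>For W \<ge> 0 the deviation from \<mu> is at most the larger of W and \<mu>, which gives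
  the factor 2 where the triangle inequality in L3 would give 8. Applied to X^2 Y^2, the factor 2
  fits exactly the coefficient of the corresponding summand of \<open>H2\<close>.\<close>

lemma third_moment_centered_le:
  fixes W :: "'a \<Rightarrow> real"
  assumes "prob_space N" and int1: "integrable N W" and int3: "integrable N (\<lambda>\<omega>. W \<omega> ^ 3)"
    and nonneg: "\<And>\<omega>. 0 \<le> W \<omega>" and \<mu>: "(\<integral>\<omega>. W \<omega> \<partial>N) = \<mu>"
  shows "integrable N (\<lambda>\<omega>. \<bar>W \<omega> - \<mu>\<bar> ^ 3)"
    and "(\<integral>\<omega>. \<bar>W \<omega> - \<mu>\<bar> ^ 3 \<partial>N) \<le> 2 * (\<integral>\<omega>. W \<omega> ^ 3 \<partial>N)"
proof -
  interpret N: prob_space N by fact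
  have [measurable]: "W \<in> borel_measurable N" using int1 by simp
  have \<mu>0: "0 \<le> \<mu>" using \<mu> nonneg by (metis Bochner_Integration.integral_nonneg)
  have le: "\<bar>W \<omega> - \<mu>\<bar> ^ 3 \<le> W \<omega> ^ 3 + \<mu> ^ 3" for \<omega>
  proof (cases "W \<omega> \<le> \<mu>")
    case True
    then have "\<bar>W \<omega> - \<mu>\<bar> ^ 3 \<le> \<mu> ^ 3" using nonneg[of \<omega>] by (intro power_mono) auto
    then show ?thesis using nonneg[of \<omega>] by (simp add: add_increasing)
  next
    case False
    then have "\<bar>W \<omega> - \<mu>\<bar> ^ 3 \<le> W \<omega> ^ 3" using \<mu>0 by (intro power_mono) auto
    then show ?thesis using \<mu>0 by (simp add: add_increasing2)
  qed
  have int: "integrable N (\<lambda>\<omega>. W \<omega> ^ 3 + \<mu> ^ 3)" using int3 by simp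
  show *: "integrable N (\<lambda>\<omega>. \<bar>W \<omega> - \<mu>\<bar> ^ 3)"
    by (rule Bochner_Integration.integrable_bound[OF int])
       (use le in \<open>auto intro!: AE_I2 intro: order_trans[OF _ abs_ge_self]\<close>)
  \<comment> \<open>Jensen's inequality through the tangent of the cube at \<mu>; the remainder
    factors as (W - \<mu>)^2 (W + 2 \<mu>).\<close>
  have "\<mu> ^ 3 = (\<integral>\<omega>. \<mu> ^ 3 + 3 * \<mu>\<^sup>2 * (W \<omega> - \<mu>) \<partial>N)"
    using int1 \<mu> by (simp add: N.prob_space)
  also have "\<dots> \<le> (\<integral>\<omega>. W \<omega> ^ 3 \<partial>N)"
  proof (intro integral_mono)
    fix \<omega>
    have "0 \<le> (W \<omega> - \<mu>)\<^sup>2 * (W \<omega> + 2 * \<mu>)" using nonneg[of \<omega>] \<mu>0 by simp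
    then show "\<mu> ^ 3 + 3 * \<mu>\<^sup>2 * (W \<omega> - \<mu>) \<le> W \<omega> ^ 3"
      by (simp add: power2_eq_square power3_eq_cube algebra_simps)
  qed (use int1 int3 in auto)
  finally have \<mu>3: "\<mu> ^ 3 \<le> (\<integral>\<omega>. W \<omega> ^ 3 \<partial>N)" .
  have "(\<integral>\<omega>. \<bar>W \<omega> - \<mu>\<bar> ^ 3 \<partial>N) \<le> (\<integral>\<omega>. W \<omega> ^ 3 + \<mu> ^ 3 \<partial>N)"
    by (rule integral_mono[OF * int le])
  also have "\<dots> = (\<integral>\<omega>. W \<omega> ^ 3 \<partial>N) + \<mu> ^ 3"
    using int3 by (simp add: N.prob_space)
  finally show "(\<integral>\<omega>. \<bar>W \<omega> - \<mu>\<bar> ^ 3 \<partial>N) \<le> 2 * (\<integral>\<omega>. W \<omega> ^ 3 \<partial>N)" using \<mu>3 by simp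
qed

text \<open>Log-convexity of norms bounds the cube of the L2 norm of xy by its L1 norm times the
  square of its L4 norm, and Cauchy-Schwarz bounds the L1 norm by sX sY. Both are obtained by
  integrating weighted pointwise inequalities.\<close>

lemma moment_interpolation:
  fixes x y :: "'a \<Rightarrow> real" and sX sY a L :: real
  assumes [measurable]: "x \<in> borel_measurable N" "y \<in> borel_measurable N"
    and int: "integrable N (\<lambda>\<omega>. (x \<omega>)\<^sup>2)" "integrable N (\<lambda>\<omega>. (y \<omega>)\<^sup>2)"
      "integrable N (\<lambda>\<omega>. (x \<omega> * y \<omega>)\<^sup>2)" "integrable N (\<lambda>\<omega>. (x \<omega> * y \<omega>) ^ 4)"
    and eq: "(\<integral>\<omega>. (x \<omega>)\<^sup>2 \<partial>N) = sX\<^sup>2" "(\<integral>\<omega>. (y \<omega>)\<^sup>2 \<partial>N) = sY\<^sup>2"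
      "(\<integral>\<omega>. (x \<omega> * y \<omega>)\<^sup>2 \<partial>N) = a\<^sup>2" "(\<integral>\<omega>. (x \<omega> * y \<omega>) ^ 4 \<partial>N) = L\<^sup>2"
    and pos: "0 < sX" "0 < sY" "0 < a" "0 \<le> L"
  shows "a ^ 3 \<le> sX * sY * L"
proof -
  define s where "s = sX * sY"
  \<comment> \<open>This weight turns the linear term of the pointwise bound into 2/3 of a^2, so
    that a third of a^2 is left after absorption.\<close>
  define l where "l = a\<^sup>2 / s"
  have s: "0 < s" and l: "0 < l" using pos by (auto simp: s_def l_def)
  have abs_int: "integrable N (\<lambda>\<omega>. \<bar>x \<omega> * y \<omega>\<bar>)" and abs_le: "(\<integral>\<omega>. \<bar>x \<omega> * y \<omega>\<bar> \<partial>N) \<le> s"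
  proof -
    \<comment> \<open>The weights balance the arithmetic-geometric mean: each of the two squares
      integrates to s.\<close>
    define g where "g \<omega> = (sY / sX * (x \<omega>)\<^sup>2 + sX / sY * (y \<omega>)\<^sup>2) / 2" for \<omega>
    have g: "\<bar>x \<omega> * y \<omega>\<bar> \<le> g \<omega>" for \<omega>
    proof -
      have "0 \<le> (sY * \<bar>x \<omega>\<bar> - sX * \<bar>y \<omega>\<bar>)\<^sup>2" by simp
      then have "2 * sX * sY * \<bar>x \<omega> * y \<omega>\<bar> \<le> sY\<^sup>2 * (x \<omega>)\<^sup>2 + sX\<^sup>2 * (y \<omega>)\<^sup>2"
        by (simp add: power2_diff power_mult_distrib abs_mult algebra_simps)
      then show ?thesis
        using pos by (simp add: g_def field_simps power2_eq_square)
    qed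
    have gi: "integrable N g" unfolding g_def using int by auto
    show i: "integrable N (\<lambda>\<omega>. \<bar>x \<omega> * y \<omega>\<bar>)"
      by (rule Bochner_Integration.integrable_bound[OF gi])
         (use g in \<open>auto intro!: AE_I2 intro: order_trans[OF _ abs_ge_self]\<close>)
    have "(\<integral>\<omega>. \<bar>x \<omega> * y \<omega>\<bar> \<partial>N) \<le> (\<integral>\<omega>. g \<omega> \<partial>N)"
      by (rule integral_mono[OF i gi g])
    also have "\<dots> = s"
      unfolding g_def using int eq pos by (simp add: s_def power2_eq_square)
    finally show "(\<integral>\<omega>. \<bar>x \<omega> * y \<omega>\<bar> \<partial>N) \<le> s" .
  qed
  \<comment> \<open>A polynomial in w that touches w^2 to second order at w = l; the difference is a
    positive multiple of w (w - l)^2 (w + 2 l).\<close>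
  have young: "w\<^sup>2 \<le> 2 / 3 * l * w + w ^ 4 / (3 * l\<^sup>2)" if "0 \<le> w" for w :: real
  proof -
    have "0 \<le> w * (w - l)\<^sup>2 * (w + 2 * l)" using that l by simp
    then have "3 * l\<^sup>2 * w\<^sup>2 \<le> 2 * l ^ 3 * w + w ^ 4"
      by (simp add: power2_eq_square power3_eq_cube power4_eq_xxxx algebra_simps)
    then show ?thesis
      using l by (simp add: field_simps power2_eq_square power3_eq_cube)
  qed
  have "a\<^sup>2 = (\<integral>\<omega>. (x \<omega> * y \<omega>)\<^sup>2 \<partial>N)" using eq by simp
  also have "\<dots> \<le> (\<integral>\<omega>. 2 / 3 * l * \<bar>x \<omega> * y \<omega>\<bar> + (x \<omega> * y \<omega>) ^ 4 / (3 * l\<^sup>2) \<partial>N)"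
  proof (rule integral_mono)
    show "(x \<omega> * y \<omega>)\<^sup>2 \<le> 2 / 3 * l * \<bar>x \<omega> * y \<omega>\<bar> + (x \<omega> * y \<omega>) ^ 4 / (3 * l\<^sup>2)" for \<omega>
      using young[of "\<bar>x \<omega> * y \<omega>\<bar>"] by simp
  qed (use int abs_int in auto)
  also have "\<dots> = 2 / 3 * l * (\<integral>\<omega>. \<bar>x \<omega> * y \<omega>\<bar> \<partial>N) + L\<^sup>2 / (3 * l\<^sup>2)"
    using int abs_int eq by simp
  also have "\<dots> \<le> 2 / 3 * l * s + L\<^sup>2 / (3 * l\<^sup>2)"
    using abs_le l by (intro add_right_mono mult_left_mono) auto
  also have "\<dots> = 2 / 3 * a\<^sup>2 + L\<^sup>2 * s\<^sup>2 / (3 * (a\<^sup>2)\<^sup>2)"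
    using s by (simp add: l_def power_divide)
  finally have "a\<^sup>2 * (a\<^sup>2)\<^sup>2 \<le> L\<^sup>2 * s\<^sup>2"
    using pos by (simp add: field_simps)
  then have "(a ^ 3)\<^sup>2 \<le> (s * L)\<^sup>2"
    by (simp add: power_mult_distrib mult.commute flip: power_mult power_add)
  then have "a ^ 3 \<le> s * L"
    by (rule power2_le_imp_le) (use pos s in simp)
  then show ?thesis by (simp add: s_def)
qed

section \<open>Normal approximation of the test statistic\<close>

text \<open>Here \<open>k = 1 / K\<close>, \<open>q = \<parallel>X\<parallel>\<^sub>4\<^sup>2\<close> and \<open>L = \<parallel>XY\<parallel>\<^sub>4\<^sup>2\<close>. The second conclusion follows by
  multiplying the two bounds on \<open>k\<close>; it is what makes Minkowski's inequality affordable for the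
  effect of the estimated slope on the residuals.\<close>

lemma K_consequences:
  fixes sX sY a q k L :: real
  assumes pos: "0 < sX" "0 < sY" "0 < a" "0 < q" "0 < k" "0 < L"
    and k2: "4 * L \<le> k * a\<^sup>2" and k3': "1152 * q\<^sup>2 * sY \<le> k * (sX ^ 3 * a)"
    and q: "sX\<^sup>2 \<le> q" and L: "a ^ 3 \<le> sX * sY * L"
  shows "1152 * (sX * sY) \<le> k * a" "67 * q \<le> k * sX\<^sup>2"
proof -
  have "1152 * (sX * sY) * sX ^ 3 = 1152 * (sX\<^sup>2)\<^sup>2 * sY"
    by (simp add: power2_eq_square power3_eq_cube)
  also have "\<dots> \<le> 1152 * q\<^sup>2 * sY"
    using q pos by (intro mult_right_mono mult_left_mono power_mono) auto
  also have "\<dots> \<le> k * a * sX ^ 3" using k3' by (simp add: mult.commute mult.left_commute)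
  finally show "1152 * (sX * sY) \<le> k * a"
    using pos by simp
  have "4608 * q\<^sup>2 * (sY * L) = (4 * L) * (1152 * q\<^sup>2 * sY)" by simp
  also have "\<dots> \<le> (k * a\<^sup>2) * (k * (sX ^ 3 * a))"
    by (rule mult_mono[OF k2 k3']) (use pos in auto)
  also have "\<dots> = k\<^sup>2 * sX ^ 3 * a ^ 3"
    by (simp add: power2_eq_square power3_eq_cube)
  also have "\<dots> \<le> k\<^sup>2 * sX ^ 3 * (sX * sY * L)"
    using L pos by (intro mult_left_mono) auto
  also have "\<dots> = (k * sX\<^sup>2)\<^sup>2 * (sY * L)"
    by (simp add: power2_eq_square power3_eq_cube)
  finally have "4608 * q\<^sup>2 \<le> (k * sX\<^sup>2)\<^sup>2"
    using pos by (simp add: mult_le_cancel_right)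
  \<comment> \<open>67^2 = 4489, and 4608 = 4 * 1152.\<close>
  moreover have "(67 * q)\<^sup>2 \<le> 4608 * q\<^sup>2"
    by (simp add: power_mult_distrib)
  ultimately have "(67 * q)\<^sup>2 \<le> (k * sX\<^sup>2)\<^sup>2" by linarith
  then show "67 * q \<le> k * sX\<^sup>2"
    by (rule power2_le_imp_le) (use pos in simp)
qed

text \<open>The multiplicative change of the threshold is charged by dilation and so is free of
  \<gamma>, the additive one by the Lipschitz bound. The factor 2 comes from 1 / (1 - \<delta>)
  \<le> 2.\<close>

lemma Phi_perturbation:
  assumes "0 < \<gamma>" "0 \<le> \<delta>" "\<delta> \<le> 1 / 2" "0 \<le> \<eta>"
  shows "Phi (- (\<gamma> * (1 - \<delta>) - \<eta>)) \<le> Phi (- \<gamma>) + (2 * \<delta> + \<eta>) / sqrt (2 * pi)"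
    and "Phi (- \<gamma>) \<le> Phi (- (\<gamma> * (1 + \<delta>) + \<eta>)) + (2 * \<delta> + \<eta>) / sqrt (2 * pi)"
proof -
  have s: "0 < sqrt (2 * pi)" by simp
  have le: "\<gamma> * (1 - \<delta>) \<le> \<gamma>" "\<gamma> \<le> \<gamma> * (1 + \<delta>)" "0 < \<gamma> * (1 - \<delta>)"
    using assms by (auto simp: mult_le_cancel_left1 algebra_simps)
  have "Phi \<gamma> - Phi (\<gamma> * (1 - \<delta>)) \<le> (\<gamma> - \<gamma> * (1 - \<delta>)) / (\<gamma> * (1 - \<delta>)) / sqrt (2 * pi)"
    by (rule Phi_dilation) (use le in auto)
  also have "(\<gamma> - \<gamma> * (1 - \<delta>)) / (\<gamma> * (1 - \<delta>)) = \<delta> / (1 - \<delta>)"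
    using assms by (simp add: field_simps)
  also have "\<delta> / (1 - \<delta>) \<le> 2 * \<delta>"
  proof -
    have "\<delta> * 1 \<le> \<delta> * (2 * (1 - \<delta>))" using assms by (intro mult_left_mono) auto
    then show ?thesis using assms by (simp add: divide_le_eq mult.commute mult.left_commute)
  qed
  finally have 1: "Phi \<gamma> - Phi (\<gamma> * (1 - \<delta>)) \<le> 2 * \<delta> / sqrt (2 * pi)"
    using s by (simp add: divide_right_mono)
  have 2: "Phi (\<gamma> * (1 - \<delta>)) - Phi (\<gamma> * (1 - \<delta>) - \<eta>) \<le> \<eta> / sqrt (2 * pi)"
    using Phi_lipschitz[of "\<gamma> * (1 - \<delta>) - \<eta>" "\<gamma> * (1 - \<delta>)"] assms by simp
  show "Phi (- (\<gamma> * (1 - \<delta>) - \<eta>)) \<le> Phi (- \<gamma>) + (2 * \<delta> + \<eta>) / sqrt (2 * pi)"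
    unfolding Phi_minus add_divide_distrib using 1 2 by linarith
  have "Phi (\<gamma> * (1 + \<delta>)) - Phi \<gamma> \<le> (\<gamma> * (1 + \<delta>) - \<gamma>) / \<gamma> / sqrt (2 * pi)"
    by (rule Phi_dilation) (use le assms in auto)
  also have "(\<gamma> * (1 + \<delta>) - \<gamma>) / \<gamma> = \<delta>"
    using assms by (simp add: field_simps)
  also have "\<delta> / sqrt (2 * pi) \<le> 2 * \<delta> / sqrt (2 * pi)"
    using assms s by (intro divide_right_mono) auto
  finally have 3: "Phi (\<gamma> * (1 + \<delta>)) - Phi \<gamma> \<le> 2 * \<delta> / sqrt (2 * pi)" .
  have 4: "Phi (\<gamma> * (1 + \<delta>) + \<eta>) - Phi (\<gamma> * (1 + \<delta>)) \<le> \<eta> / sqrt (2 * pi)"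
    using Phi_lipschitz[of "\<gamma> * (1 + \<delta>)" "\<gamma> * (1 + \<delta>) + \<eta>"] assms by simp
  show "Phi (- \<gamma>) \<le> Phi (- (\<gamma> * (1 + \<delta>) + \<eta>)) + (2 * \<delta> + \<eta>) / sqrt (2 * pi)"
    unfolding Phi_minus add_divide_distrib using 3 4 by linarith
qed

text \<open>Off \<open>Bad\<close> the rejection event is trapped between two two-sided events for
  \<open>W\<close>. Each tail pays for the perturbed threshold and for one Berry-Esseen error, hence
  the factors 2.\<close>

lemma (in iid_sample) two_sided_sandwich:
  assumes BE: "\<And>x. \<bar>\<P>(\<omega> in M. W \<omega> \<le> x) - Phi x\<bar> \<le> B"
    and W[measurable]: "W \<in> borel_measurable M" and T[measurable]: "T \<in> borel_measurable M"
    and Bad: "Bad \<in> sets M" "M.prob Bad \<le> b"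
    and approx: "\<And>\<omega>. \<omega> \<in> space M \<Longrightarrow> \<omega> \<notin> Bad \<Longrightarrow>
      (\<gamma> \<le> T \<omega> \<longrightarrow> \<gamma> * (1 - \<delta>) - \<eta> \<le> \<bar>W \<omega>\<bar>) \<and> (\<gamma> * (1 + \<delta>) + \<eta> \<le> \<bar>W \<omega>\<bar> \<longrightarrow> \<gamma> \<le> T \<omega>)"
    and \<gamma>: "0 < \<gamma>" "0 \<le> \<delta>" "\<delta> \<le> 1 / 2" "0 \<le> \<eta>"
  shows "\<bar>\<P>(\<omega> in M. \<gamma> \<le> T \<omega>) - 2 * Phi (- \<gamma>)\<bar> \<le> 2 * (2 * \<delta> + \<eta>) / sqrt (2 * pi) + 2 * B + b"
proof -
  have two: "2 * (2 * \<delta> + \<eta>) / sqrt (2 * pi) = 2 * ((2 * \<delta> + \<eta>) / sqrt (2 * pi))" by simp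
  have "\<P>(\<omega> in M. \<gamma> \<le> T \<omega>) \<le>
      M.prob ({\<omega> \<in> space M. \<gamma> * (1 - \<delta>) - \<eta> \<le> \<bar>W \<omega>\<bar>} \<union> Bad)"
    using approx Bad by (intro M.finite_measure_mono) auto
  also have "\<dots> \<le> \<P>(\<omega> in M. \<gamma> * (1 - \<delta>) - \<eta> \<le> \<bar>W \<omega>\<bar>) + M.prob Bad"
    by (rule measure_Un_le) (use Bad in auto)
  also have "\<dots> \<le> 2 * Phi (- (\<gamma> * (1 - \<delta>) - \<eta>)) + 2 * B + b"
    using two_sided(1)[OF BE W] Bad(2) by (intro add_mono)
  finally have upper: "\<P>(\<omega> in M. \<gamma> \<le> T \<omega>) \<le>
      2 * Phi (- \<gamma>) + 2 * (2 * \<delta> + \<eta>) / sqrt (2 * pi) + 2 * B + b"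
    using Phi_perturbation(1)[OF \<gamma>] unfolding two by linarith
  have "0 < \<gamma> * (1 + \<delta>) + \<eta>" using \<gamma> by (simp add: add_pos_nonneg)
  from two_sided(2)[OF BE W this]
  have "2 * Phi (- (\<gamma> * (1 + \<delta>) + \<eta>)) - 2 * B \<le> \<P>(\<omega> in M. \<gamma> * (1 + \<delta>) + \<eta> \<le> \<bar>W \<omega>\<bar>)" .
  also have "\<dots> \<le> M.prob ({\<omega> \<in> space M. \<gamma> \<le> T \<omega>} \<union> Bad)"
    using approx Bad by (intro M.finite_measure_mono) auto
  also have "\<dots> \<le> \<P>(\<omega> in M. \<gamma> \<le> T \<omega>) + M.prob Bad"
    by (rule measure_Un_le) (use Bad in auto)
  finally show ?thesis
    using upper Phi_perturbation(2)[OF \<gamma>] Bad(2) unfolding two by linarith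
qed

text \<open>\<open>k2\<close> and \<open>k3\<close> come from K, while \<open>kn\<close>,
  \<open>qn\<close>, \<open>yn\<close> hold in the non-trivial regime; formulating them for plain
  numbers separates the analysis from the bookkeeping of norms. The 8 is 2 for each of the four
  exceptional events on the scale r.\<close>

lemma test_stat_berry_esseen:
  fixes M :: "'a measure" and N :: "'b measure"
    and U :: "nat \<Rightarrow> 'a \<Rightarrow> real \<times> real" and U0 :: "'b \<Rightarrow> real \<times> real" and n :: nat
    and sX sY a q k L v c \<gamma> :: real
  defines "E \<equiv> \<lambda>f :: real \<times> real \<Rightarrow> real. \<integral>\<omega>. f (U0 \<omega>) \<partial>N"
  assumes iid: "iid_sample M N n U U0" and c: "berry_esseen_const c"
    and int: "integrable N (\<lambda>\<omega>. fst (U0 \<omega>) ^ 6)" "integrable N (\<lambda>\<omega>. snd (U0 \<omega>) ^ 4)"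
      "integrable N (\<lambda>\<omega>. (fst (U0 \<omega>) * snd (U0 \<omega>)) ^ 6)"
      "integrable N (\<lambda>\<omega>. \<bar>fst (U0 \<omega>)\<bar> ^ 3)" "integrable N (\<lambda>\<omega>. \<bar>snd (U0 \<omega>)\<bar> ^ 3)"
      "integrable N (\<lambda>\<omega>. \<bar>fst (U0 \<omega>) * snd (U0 \<omega>)\<bar> ^ 3)"
      "integrable N (\<lambda>\<omega>. (fst (U0 \<omega>))\<^sup>2)" "integrable N (\<lambda>\<omega>. (snd (U0 \<omega>))\<^sup>2)"
      "integrable N (\<lambda>\<omega>. fst (U0 \<omega>) ^ 4)" "integrable N (\<lambda>\<omega>. (fst (U0 \<omega>) * snd (U0 \<omega>))\<^sup>2)"
      "integrable N (\<lambda>\<omega>. (fst (U0 \<omega>) * snd (U0 \<omega>)) ^ 4)"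
    and centered: "E fst = 0" "E snd = 0" "E (\<lambda>u. fst u * snd u) = 0"
    and mom: "E (\<lambda>u. (fst u)\<^sup>2) = sX\<^sup>2" "E (\<lambda>u. (snd u)\<^sup>2) = sY\<^sup>2"
      "E (\<lambda>u. (fst u * snd u)\<^sup>2) = a\<^sup>2" "E (\<lambda>u. fst u ^ 4) = q\<^sup>2"
      "E (\<lambda>u. (fst u * snd u) ^ 4) = L\<^sup>2"
      "E (\<lambda>u. ((fst u * snd u)\<^sup>2 - a\<^sup>2)\<^sup>2) = v\<^sup>2"
    and pos: "0 < sX" "0 < sY" "0 < a" "0 < q" "0 < k" "0 < L" "0 < v" "0 < \<gamma>"
    and k2: "4 * L \<le> k * a\<^sup>2" and k3: "1152 * q\<^sup>2 * sY \<le> k * (sX ^ 3 * a)"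
    and n: "50 \<le> n" and kn: "k * (ln (real n) / sqrt (real n)) \<le> 3 / 2"
    and qn: "64 * (q / sX\<^sup>2) \<le> sqrt (real n)"
    and yn: "16 * (sqrt (E (\<lambda>u. snd u ^ 4)) / sY\<^sup>2) \<le> sqrt (real n)"
  shows "\<bar>\<P>(\<omega> in M. \<gamma> \<le> test_stat d\<^sub>1 d\<^sub>2 d\<^sub>3 n (\<lambda>i. fst (U i \<omega>)) (\<lambda>i. snd (U i \<omega>)))
      - 2 * Phi (- \<gamma>)\<bar> \<le>
    2 * k * (ln (real n) / sqrt (real n)) / sqrt (2 * pi) +
    (8 + 2 * c * (E (\<lambda>u. \<bar>fst u\<bar> ^ 3) / sX ^ 3) + 2 * c * (E (\<lambda>u. \<bar>snd u\<bar> ^ 3) / sY ^ 3)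
      + 4 * c * (E (\<lambda>u. \<bar>fst u * snd u\<bar> ^ 3) / a ^ 3)
      + 4 * c * (E (\<lambda>u. (fst u * snd u) ^ 6) / v ^ 3)
      + 2 * (E (\<lambda>u. fst u ^ 6) / q ^ 3) + q / sX\<^sup>2 + sqrt (E (\<lambda>u. snd u ^ 4)) / sY\<^sup>2) / sqrt (real n)"
proof -
  interpret iid_sample M N n U U0 by fact
  note [simp] = E_def
  have n0: "0 < real n" "1 \<le> n" "0 < sqrt (real n)" using n by auto
  have c0: "0 < c" using c by (simp add: berry_esseen_const_def)
  have fst_snd[measurable]: "(fst :: real \<times> real \<Rightarrow> real) \<in> borel_measurable borel"
      "(snd :: real \<times> real \<Rightarrow> real) \<in> borel_measurable borel"
    by (simp_all flip: borel_prod)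
  have U0m: "(\<lambda>\<omega>. fst (U0 \<omega>)) \<in> borel_measurable N" "(\<lambda>\<omega>. snd (U0 \<omega>)) \<in> borel_measurable N"
    by (rule measurable_compose[OF U0 fst_snd(1)], rule measurable_compose[OF U0 fst_snd(2)])
  define l where "l = ln (real n)"
  have l: "1 \<le> l"
  proof -
    have "exp 1 \<le> real n" using exp_le n by linarith
    then show ?thesis using n0 by (simp add: l_def ln_ge_iff)
  qed
  define r where "r = sqrt l / sqrt (real n)"
  have r0: "0 < r" using l n0 by (simp add: r_def)
  have r2: "r\<^sup>2 = l / real n" using l n0 by (simp add: r_def power_divide)
  \<comment> \<open>l \<ge> 1 gives sqrt l \<le> l: the normaliser is controlled on the scale r, the
    final bound is stated on the larger scale log n / sqrt n.\<close>
  have rl: "r \<le> l / sqrt (real n)"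
    unfolding r_def using l n0 real_sqrt_le_mono[of l "l\<^sup>2"]
    by (intro divide_right_mono) (auto simp: power2_eq_square mult_le_cancel_left1)
  have kr: "k * r \<le> k * (l / sqrt (real n))"
    using rl pos by (intro mult_left_mono) auto
  have kl: "k * (l / sqrt (real n)) \<le> 3 / 2" using kn by (simp add: l_def)
  have a3: "a ^ 3 \<le> sX * sY * L"
    using moment_interpolation[OF U0m int(7,8,10,11), of sX sY a L] mom pos by simp
  have q: "sX\<^sup>2 \<le> q"
  proof -
    have "0 \<le> (\<integral>\<omega>. ((fst (U0 \<omega>))\<^sup>2 - sX\<^sup>2)\<^sup>2 \<partial>N)" by simp
    also have "\<dots> = (\<integral>\<omega>. fst (U0 \<omega>) ^ 4 - 2 * sX\<^sup>2 * (fst (U0 \<omega>))\<^sup>2 + (sX\<^sup>2)\<^sup>2 \<partial>N)"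
      by (simp add: power2_diff algebra_simps)
    also have "\<dots> = q\<^sup>2 - (sX\<^sup>2)\<^sup>2"
      using int mom by (simp add: N.prob_space power2_eq_square)
    finally have "(sX\<^sup>2)\<^sup>2 \<le> q\<^sup>2" by simp
    then show ?thesis by (rule power2_le_imp_le) (use pos in simp)
  qed
  \<comment> \<open>The deviation of the mean of X^2 Y^2 is measured by its standard deviation v,
    whereas K involves the fourth moment of XY.\<close>
  have vL: "v \<le> L"
  proof -
    have "v\<^sup>2 = (\<integral>\<omega>. (fst (U0 \<omega>) * snd (U0 \<omega>)) ^ 4 - 2 * a\<^sup>2 * (fst (U0 \<omega>) * snd (U0 \<omega>))\<^sup>2 + (a\<^sup>2)\<^sup>2 \<partial>N)"
      using mom(6) by (simp add: power2_diff algebra_simps)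
    also have "\<dots> = L\<^sup>2 - (a\<^sup>2)\<^sup>2"
      using int mom by (simp add: N.prob_space power2_eq_square)
    also have "\<dots> \<le> L\<^sup>2" by simp
    finally show ?thesis using pos by (simp add: power2_le_iff_abs_le)
  qed
  note K = K_consequences[OF pos(1-6) k2 k3 q a3]
  \<comment> \<open>\<open>K(2)\<close> and sX^2 \<le> q force k \<ge> 67, so k r \<le> 3/2 yields r
    \<le> 3/134.\<close>
  have r_small: "r \<le> 1 / 40"
  proof -
    have "67 * sX\<^sup>2 \<le> k * sX\<^sup>2" using K(2) q by linarith
    then have "67 \<le> k" using pos by simp
    then have "67 * r \<le> k * r" using r0 by (intro mult_right_mono) auto
    then show ?thesis using kr kl by linarith
  qed
  have kr': "k * r \<le> 3 / 2" using kr kl by linarith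
  define x y where "x \<omega> i = fst (U i \<omega>)" and "y \<omega> i = snd (U i \<omega>)" for \<omega> i
  define T where "T \<omega> = test_stat d\<^sub>1 d\<^sub>2 d\<^sub>3 n (x \<omega>) (y \<omega>)" for \<omega>
  have T[measurable]: "T \<in> borel_measurable M"
    unfolding T_def x_def y_def
    by (intro measurable_test_stat measurable_compose[OF U_measurable]) auto
  have avg_mean: "avg f \<omega> = mean n (\<lambda>i. f (U i \<omega>))" for f \<omega>
    by (simp add: avg_def mean_def)
  define W where "W \<omega> = sqrt (real n) * avg (\<lambda>u. fst u * snd u) \<omega> / a" for \<omega>
  have W[measurable]: "W \<in> borel_measurable M" unfolding W_def by measurable
  define \<beta> where "\<beta> = E (\<lambda>u. \<bar>fst u * snd u\<bar> ^ 3) / a ^ 3"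
  have BE: "\<bar>\<P>(\<omega> in M. W \<omega> \<le> t) - Phi t\<bar> \<le> c * \<beta> / sqrt (real n)" for t
    using berry_esseen[OF c, of "\<lambda>u. fst u * snd u" a t] int centered mom pos
    by (simp add: W_def \<beta>_def)
  define Y4 where "Y4 = E (\<lambda>u. snd u ^ 4)"
  have Y4: "0 \<le> Y4" by (simp add: Y4_def)

  \<comment> \<open>Exceptional events and their probabilities\<close>
  define B1 where "B1 = {\<omega> \<in> space M. sX * r \<le> \<bar>avg fst \<omega>\<bar>}"
  define B2 where "B2 = {\<omega> \<in> space M. sY * r \<le> \<bar>avg snd \<omega>\<bar>}"
  define B3 where "B3 = {\<omega> \<in> space M. a * r \<le> \<bar>avg (\<lambda>u. fst u * snd u) \<omega>\<bar>}"
  define B4 where "B4 = {\<omega> \<in> space M. v * r \<le> \<bar>avg (\<lambda>u. (fst u * snd u)\<^sup>2 - a\<^sup>2) \<omega>\<bar>}"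
  define B5 where "B5 = {\<omega> \<in> space M. sX\<^sup>2 / 4 \<le> \<bar>avg (\<lambda>u. (fst u)\<^sup>2) \<omega> - sX\<^sup>2\<bar>}"
  define B6 where "B6 = {\<omega> \<in> space M. sY\<^sup>2 / 4 \<le> \<bar>avg (\<lambda>u. (snd u)\<^sup>2) \<omega> - sY\<^sup>2\<bar>}"
  define B7 where "B7 = {\<omega> \<in> space M. 2 * q\<^sup>2 \<le> avg (\<lambda>u. fst u ^ 4) \<omega>}"
  define Bad where "Bad = B1 \<union> B2 \<union> B3 \<union> B4 \<union> B5 \<union> B6 \<union> B7"
  have sets: "B1 \<in> sets M" "B2 \<in> sets M" "B3 \<in> sets M" "B4 \<in> sets M" "B5 \<in> sets M"
      "B6 \<in> sets M" "B7 \<in> sets M"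
    unfolding B1_def B2_def B3_def B4_def B5_def B6_def B7_def by measurable
  have b1: "M.prob B1 \<le> (2 + 2 * c * (E (\<lambda>u. \<bar>fst u\<bar> ^ 3) / sX ^ 3)) / sqrt (real n)"
    using log_tail[OF c, of fst sX] int centered mom pos by (simp add: B1_def r_def l_def)
  have b2: "M.prob B2 \<le> (2 + 2 * c * (E (\<lambda>u. \<bar>snd u\<bar> ^ 3) / sY ^ 3)) / sqrt (real n)"
    using log_tail[OF c, of snd sY] int centered mom pos by (simp add: B2_def r_def l_def)
  have b3: "M.prob B3 \<le> (2 + 2 * c * \<beta>) / sqrt (real n)"
    using log_tail[OF c, of "\<lambda>u. fst u * snd u" a] int centered mom pos
    by (simp add: B3_def r_def l_def \<beta>_def)
  have b4: "M.prob B4 \<le> (2 + 4 * c * (E (\<lambda>u. (fst u * snd u) ^ 6) / v ^ 3)) / sqrt (real n)"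
  proof -
    have int6: "integrable N (\<lambda>\<omega>. ((fst (U0 \<omega>) * snd (U0 \<omega>))\<^sup>2) ^ 3)"
      using int(3) by (simp flip: power_mult)
    have third: "integrable N (\<lambda>\<omega>. \<bar>(fst (U0 \<omega>) * snd (U0 \<omega>))\<^sup>2 - a\<^sup>2\<bar> ^ 3)"
      "(\<integral>\<omega>. \<bar>(fst (U0 \<omega>) * snd (U0 \<omega>))\<^sup>2 - a\<^sup>2\<bar> ^ 3 \<partial>N) \<le>
        2 * (\<integral>\<omega>. ((fst (U0 \<omega>) * snd (U0 \<omega>))\<^sup>2) ^ 3 \<partial>N)"
      using third_moment_centered_le[OF prob_N int(10) int6] mom(3) by simp_all
    have third': "E (\<lambda>u. \<bar>(fst u * snd u)\<^sup>2 - a\<^sup>2\<bar> ^ 3) \<le> 2 * E (\<lambda>u. (fst u * snd u) ^ 6)"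
      using third(2) by (simp flip: power_mult)
    have "M.prob B4 \<le> (2 + 2 * c * (E (\<lambda>u. \<bar>(fst u * snd u)\<^sup>2 - a\<^sup>2\<bar> ^ 3) / v ^ 3)) / sqrt (real n)"
      using log_tail[OF c, of "\<lambda>u. (fst u * snd u)\<^sup>2 - a\<^sup>2" v] third(1) int(10) mom pos
      by (simp add: B4_def r_def l_def N.prob_space)
    also have "\<dots> \<le> (2 + 2 * c * (2 * E (\<lambda>u. (fst u * snd u) ^ 6) / v ^ 3)) / sqrt (real n)"
      using third' c0 pos by (intro divide_right_mono add_left_mono mult_left_mono) auto
    also have "\<dots> = (2 + 4 * c * (E (\<lambda>u. (fst u * snd u) ^ 6) / v ^ 3)) / sqrt (real n)"
      by simp
    finally show ?thesis .
  qed
  \<comment> \<open>Chebyshev's inequality gives a squared ratio over n; one factor of the ratio is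
    exchanged for sqrt n.\<close>
  have cheb: "16 * Q\<^sup>2 / real n \<le> Q / sqrt (real n)" if "0 \<le> Q" "16 * Q \<le> sqrt (real n)" for Q
  proof -
    have "16 * Q\<^sup>2 / real n = (16 * Q) * Q / (sqrt (real n) * sqrt (real n))"
      using n0 by (simp add: power2_eq_square)
    also have "\<dots> \<le> sqrt (real n) * Q / (sqrt (real n) * sqrt (real n))"
      using that n0 by (intro divide_right_mono mult_right_mono) auto
    also have "\<dots> = Q / sqrt (real n)"
      using n0 by (intro nonzero_mult_divide_mult_cancel_left) auto
    finally show ?thesis .
  qed
  have b5: "M.prob B5 \<le> q / sX\<^sup>2 / sqrt (real n)"
  proof -
    have "M.prob B5 \<le> E (\<lambda>u. ((fst u)\<^sup>2)\<^sup>2) / (real n * (sX\<^sup>2 / 4)\<^sup>2)"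
      using chebyshev[of "\<lambda>u. (fst u)\<^sup>2" "sX\<^sup>2 / 4"] int mom pos by (simp add: B5_def)
    also have "\<dots> = 16 * (q / sX\<^sup>2)\<^sup>2 / real n"
      using mom(4) by (simp add: power_divide mult.commute)
    also have "\<dots> \<le> q / sX\<^sup>2 / sqrt (real n)"
    proof (rule cheb)
      show "0 \<le> q / sX\<^sup>2" using pos by simp
      then show "16 * (q / sX\<^sup>2) \<le> sqrt (real n)" using qn by linarith
    qed
    finally show ?thesis .
  qed
  have b6: "M.prob B6 \<le> sqrt Y4 / sY\<^sup>2 / sqrt (real n)"
  proof -
    have "M.prob B6 \<le> E (\<lambda>u. ((snd u)\<^sup>2)\<^sup>2) / (real n * (sY\<^sup>2 / 4)\<^sup>2)"
      using chebyshev[of "\<lambda>u. (snd u)\<^sup>2" "sY\<^sup>2 / 4"] int mom pos by (simp add: B6_def)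
    also have "\<dots> = 16 * (sqrt Y4 / sY\<^sup>2)\<^sup>2 / real n"
      using Y4 by (simp add: power_divide) (simp add: Y4_def mult.commute)
    also have "\<dots> \<le> sqrt Y4 / sY\<^sup>2 / sqrt (real n)"
      by (rule cheb) (use pos yn Y4 in \<open>auto simp: Y4_def\<close>)
    finally show ?thesis .
  qed
  have b7: "M.prob B7 \<le> 2 * (E (\<lambda>u. fst u ^ 6) / q ^ 3) / sqrt (real n)"
    using fourth_moment_tail[of fst "q\<^sup>2"] int mom pos by (simp add: B7_def)
  define b where "b = (8 + 2 * c * (E (\<lambda>u. \<bar>fst u\<bar> ^ 3) / sX ^ 3)
      + 2 * c * (E (\<lambda>u. \<bar>snd u\<bar> ^ 3) / sY ^ 3) + 2 * c * \<beta>
      + 4 * c * (E (\<lambda>u. (fst u * snd u) ^ 6) / v ^ 3)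
      + 2 * (E (\<lambda>u. fst u ^ 6) / q ^ 3) + q / sX\<^sup>2 + sqrt Y4 / sY\<^sup>2) / sqrt (real n)"
  have Bad: "Bad \<in> sets M" using sets by (simp add: Bad_def)
  have "M.prob Bad \<le> M.prob B1 + M.prob B2 + M.prob B3 + M.prob B4 + M.prob B5 + M.prob B6 + M.prob B7"
    unfolding Bad_def using sets
    by (intro order_trans[OF measure_Un_le] add_right_mono) auto
  also have "\<dots> \<le> b"
    using b1 b2 b3 b4 b5 b6 b7 unfolding b_def add_divide_distrib by linarith
  finally have prob_Bad: "M.prob Bad \<le> b" .
  \<comment> \<open>\<delta> is the relative error of the normaliser, \<eta> bounds the shift caused
    by \<open>D\<close> after division by a.\<close>
  define \<delta> \<eta> where "\<delta> = 3 / 10 * (k * r)" and "\<eta> = sqrt (real n) * (r\<^sup>2 * (k / 1152))"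
  have \<delta>: "0 \<le> \<delta>" "\<delta> \<le> 1 / 2" using kr' r0 pos by (auto simp: \<delta>_def)
  have \<eta>: "0 \<le> \<eta>" using pos n0 by (simp add: \<eta>_def)
  have approx: "(\<gamma> \<le> T \<omega> \<longrightarrow> \<gamma> * (1 - \<delta>) - \<eta> \<le> \<bar>W \<omega>\<bar>) \<and>
      (\<gamma> * (1 + \<delta>) + \<eta> \<le> \<bar>W \<omega>\<bar> \<longrightarrow> \<gamma> \<le> T \<omega>)" if \<omega>: "\<omega> \<in> space M" "\<omega> \<notin> Bad" for \<omega>
  proof -
    define m where "m = mean n (\<lambda>i. x \<omega> i * y \<omega> i)"
    have xy_fun: "x \<omega> = (\<lambda>i. fst (U i \<omega>))" "y \<omega> = (\<lambda>i. snd (U i \<omega>))"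
      by (auto simp: x_def y_def)
    have g1: "\<bar>mean n (x \<omega>)\<bar> \<le> sX * r"
      and g2: "\<bar>mean n (y \<omega>)\<bar> \<le> sY * r"
      and g3: "\<bar>m\<bar> \<le> a * r"
      and g5: "\<bar>mean n (\<lambda>i. (x \<omega> i)\<^sup>2) - sX\<^sup>2\<bar> \<le> sX\<^sup>2 / 4"
      and g6: "\<bar>mean n (\<lambda>i. (y \<omega> i)\<^sup>2) - sY\<^sup>2\<bar> \<le> sY\<^sup>2 / 4"
      and g7: "mean n (\<lambda>i. x \<omega> i ^ 4) \<le> 2 * q\<^sup>2"
      using \<omega> by (simp_all add: Bad_def B1_def B2_def B3_def B4_def B5_def B6_def B7_def
        avg_mean xy_fun m_def)
    have g4: "\<bar>mean n (\<lambda>i. (x \<omega> i * y \<omega> i)\<^sup>2) - a\<^sup>2\<bar> \<le> L * r"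
    proof -
      have "\<bar>mean n (\<lambda>i. (x \<omega> i * y \<omega> i)\<^sup>2 - a\<^sup>2)\<bar> \<le> v * r"
        using \<omega> by (simp add: Bad_def B4_def avg_mean x_def y_def)
      also have "\<dots> \<le> L * r" using vL r0 by (intro mult_right_mono) auto
      finally show ?thesis using n0 by (simp add: mean_diff mean_const)
    qed
    obtain D Q where "test_stat d\<^sub>1 d\<^sub>2 d\<^sub>3 n (x \<omega>) (y \<omega>) =
        sqrt (real n) * \<bar>mean n (\<lambda>i. x \<omega> i * y \<omega> i) - D\<bar> / Q"
      "\<bar>D\<bar> \<le> r\<^sup>2 * (k * a / 1152)" "\<bar>Q - a\<bar> \<le> 3 / 10 * (k * r) * a" "0 < Q"
      by (rule test_stat_approx[OF n0(2) pos(1-5) less_imp_le[OF r0] r_small kr' K(1) k2 K(2) q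
            g1 g2 g3[unfolded m_def] g4 g5 g6 g7])
    then have DQ: "T \<omega> = sqrt (real n) * \<bar>m - D\<bar> / Q"
      "\<bar>D\<bar> \<le> r\<^sup>2 * (k * a / 1152)" "\<bar>Q - a\<bar> \<le> \<delta> * a" "0 < Q"
      by (simp_all only: T_def m_def \<delta>_def)
    have Dn: "sqrt (real n) * \<bar>D\<bar> \<le> \<eta> * a"
      using mult_left_mono[OF DQ(2), of "sqrt (real n)"] n0 by (simp add: \<eta>_def)
    have Wm: "\<bar>W \<omega>\<bar> * a = sqrt (real n) * \<bar>m\<bar>"
      using pos by (simp add: W_def m_def avg_mean x_def y_def abs_mult)
    have T_iff: "\<gamma> \<le> T \<omega> \<longleftrightarrow> \<gamma> * Q \<le> sqrt (real n) * \<bar>m - D\<bar>"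
      using DQ(4) by (simp add: DQ(1) le_divide_eq)
    have tri: "sqrt (real n) * \<bar>m - D\<bar> \<le> sqrt (real n) * \<bar>m\<bar> + sqrt (real n) * \<bar>D\<bar>"
      "sqrt (real n) * \<bar>m\<bar> \<le> sqrt (real n) * \<bar>m - D\<bar> + sqrt (real n) * \<bar>D\<bar>"
      using n0 by (simp_all flip: distrib_left add: mult_le_cancel_left)
    have Qb: "\<gamma> * (a * (1 - \<delta>)) \<le> \<gamma> * Q" "\<gamma> * Q \<le> \<gamma> * (a * (1 + \<delta>))"
    proof -
      have "a * (1 - \<delta>) \<le> Q" "Q \<le> a * (1 + \<delta>)"
        using DQ(3) by (auto simp: abs_le_iff algebra_simps)
      then show "\<gamma> * (a * (1 - \<delta>)) \<le> \<gamma> * Q" "\<gamma> * Q \<le> \<gamma> * (a * (1 + \<delta>))"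
        using pos by simp_all
    qed
    show ?thesis
    proof (intro conjI impI)
      assume "\<gamma> \<le> T \<omega>"
      then have "\<gamma> * (a * (1 - \<delta>)) \<le> \<bar>W \<omega>\<bar> * a + \<eta> * a"
        using T_iff Qb(1) tri(1) Dn Wm by linarith
      then have "(\<gamma> * (1 - \<delta>) - \<eta>) * a \<le> \<bar>W \<omega>\<bar> * a" by (simp add: algebra_simps)
      then show "\<gamma> * (1 - \<delta>) - \<eta> \<le> \<bar>W \<omega>\<bar>" using pos by simp
    next
      assume "\<gamma> * (1 + \<delta>) + \<eta> \<le> \<bar>W \<omega>\<bar>"
      then have "(\<gamma> * (1 + \<delta>) + \<eta>) * a \<le> \<bar>W \<omega>\<bar> * a" using pos by (intro mult_right_mono) auto
      then have "\<gamma> * (a * (1 + \<delta>)) + \<eta> * a \<le> \<bar>W \<omega>\<bar> * a" by (simp add: algebra_simps)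
      then show "\<gamma> \<le> T \<omega>" using T_iff Qb(2) tri(2) Dn Wm by linarith
    qed
  qed
  have "\<bar>\<P>(\<omega> in M. \<gamma> \<le> T \<omega>) - 2 * Phi (- \<gamma>)\<bar> \<le>
      2 * (2 * \<delta> + \<eta>) / sqrt (2 * pi) + 2 * (c * \<beta> / sqrt (real n)) + b"
    by (rule two_sided_sandwich[OF BE W T Bad prob_Bad approx pos(8) \<delta> \<eta>])
  \<comment> \<open>The count is 4 * 3/10 + 2/1152 < 2.\<close>
  moreover have "2 * (2 * \<delta> + \<eta>) / sqrt (2 * pi) \<le> 2 * k * (l / sqrt (real n)) / sqrt (2 * pi)"
  proof (rule divide_right_mono)
    have "sqrt (real n) * r\<^sup>2 = l / sqrt (real n)"
      using n0 by (simp add: r2 real_div_sqrt field_simps)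
    then have "\<eta> = k * (l / sqrt (real n)) / 1152"
      by (simp add: \<eta>_def field_simps)
    moreover have "0 \<le> k * (l / sqrt (real n))" using pos l n0 by simp
    ultimately show "2 * (2 * \<delta> + \<eta>) \<le> 2 * k * (l / sqrt (real n))"
      using kr by (simp add: \<delta>_def)
  qed simp
  \<comment> \<open>The error \<beta> enters twice: in the normal approximation of \<open>W\<close>
    and in the probability of \<open>B3\<close>.\<close>
  moreover have "2 * (c * \<beta> / sqrt (real n)) + b =
    (8 + 2 * c * (E (\<lambda>u. \<bar>fst u\<bar> ^ 3) / sX ^ 3) + 2 * c * (E (\<lambda>u. \<bar>snd u\<bar> ^ 3) / sY ^ 3)
      + 4 * c * \<beta> + 4 * c * (E (\<lambda>u. (fst u * snd u) ^ 6) / v ^ 3)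
      + 2 * (E (\<lambda>u. fst u ^ 6) / q ^ 3) + q / sX\<^sup>2 + sqrt Y4 / sY\<^sup>2) / sqrt (real n)"
    unfolding b_def by (simp add: add_divide_distrib)
  ultimately show ?thesis
    unfolding T_def x_def y_def l_def \<beta>_def Y4_def by linarith
qed

section \<open>The constants\<close>

lemma Lnorm_nonneg [simp]: "0 \<le> Lnorm N r Z"
  by (simp add: Lnorm_def)

lemma powr_numeral_abs: "\<bar>z\<bar> powr numeral k = \<bar>z :: real\<bar> ^ numeral k"
  using powr_realpow'[of "\<bar>z\<bar>" "numeral k"] by simp

lemma integrable_finite_Lnorm:
  "finite_Lnorm N (numeral k) Z \<Longrightarrow> integrable N (\<lambda>\<omega>. \<bar>Z \<omega>\<bar> ^ numeral k)"
  by (simp add: finite_Lnorm_def powr_numeral_abs)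

lemma Lnorm_power: "Lnorm N (numeral k) Z ^ numeral k = (\<integral>\<omega>. \<bar>Z \<omega>\<bar> ^ numeral k \<partial>N)"
proof -
  let ?I = "\<integral>\<omega>. \<bar>Z \<omega>\<bar> ^ numeral k \<partial>N"
  have "Lnorm N (numeral k) Z ^ numeral k = (?I powr (1 / numeral k)) powr (real (numeral k))"
    by (subst powr_realpow') (simp_all add: Lnorm_def powr_numeral_abs)
  also have "\<dots> = ?I"
    by (simp only: powr_powr) simp
  finally show ?thesis .
qed

text \<open>Two members of the minimum defining \<open>Kc\<close>. With k = 1 / K they read 4 L
  \<le> k a^2 and, since 4 * 288 = 1152, 1152 q^2 sY \<le> k sX^3 a.\<close>

lemma Kc_le:
  shows "Kc N X Y \<le> Lnorm N 2 (XE N X Y) / 4 * (Lnorm N 2 (XE N X Y) / Lnorm N 4 (XE N X Y) ^ 2)"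
    and "Kc N X Y \<le> Lnorm N 2 (XE N X Y) / 4 * (sX N X ^ 3 / (288 * Lnorm N 4 (Xc N X) ^ 4 * sY N Y))"
  unfolding Kc_def by (intro mult_left_mono Min_le; simp)+

lemma sX_nonneg: "0 \<le> sX N X"
  by (simp add: sX_def)

lemma sY_nonneg: "0 \<le> sY N Y"
  by (simp add: sY_def)

lemma sE_nonneg: "0 \<le> sE N X Y"
  by (simp add: sE_def)

lemma Kc_nonneg: "0 \<le> Kc N X Y"
  unfolding Kc_def using sX_nonneg[of N X] sY_nonneg[of N Y]
  by (intro mult_nonneg_nonneg Min.boundedI) (auto split: if_splits)

lemma H1_ge: "1 / (sqrt (2 * pi) * Kc N X Y) \<le> H1 N X Y"
  using sX_nonneg[of N X] sE_nonneg[of N X Y] by (simp add: H1_def)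

lemma H3_nonneg: "0 \<le> H3 N X Y"
  using sX_nonneg[of N X] sY_nonneg[of N Y] sE_nonneg[of N X Y] Kc_nonneg[of N X Y]
  by (simp add: H3_def)

lemma H4_nonneg: "0 \<le> H4 N X Y c"
  using sX_nonneg[of N X] sY_nonneg[of N Y] sE_nonneg[of N X Y]
  by (simp add: H4_def)

lemma H5_nonneg: "0 \<le> H5 N X Y c"
  using sX_nonneg[of N X] by (simp add: H5_def)

text \<open>The retained summands match the error terms of the normal approximation and its size
  conditions; the constant 19 makes n large.\<close>

lemma H2_ge:
  fixes c :: real
  assumes "0 < c"
  shows "19 + 9 * c * Lnorm N 3 (XE N X Y) ^ 3 / Lnorm N 2 (XE N X Y) ^ 3
    + 16 * c * Lnorm N 3 (Xc N X) ^ 3 / sX N X ^ 3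
    + 2 * c * Lnorm N 6 (XE N X Y) ^ 6 / varX2E2 N X Y powr (3 / 2)
    + 6 * c * Lnorm N 3 (Yc N Y) ^ 3 / sY N Y ^ 3
    + 12 * (Lnorm N 4 (Yc N Y) ^ 2 / sY N Y ^ 2)
    + 32 * (Lnorm N 4 (Xc N X) ^ 2 / sX N X ^ 2)
    + 16 * (Lnorm N 6 (Xc N X) ^ 6 / Lnorm N 4 (Xc N X) ^ 6) \<le> H2 N X Y c"
proof -
  \<comment> \<open>The variables stand for the 26 summands of \<open>H2\<close> in their order, so
    that the linear arithmetic never sees the norms.\<close>
  have drop: "a1 + a3 + a5 + a6 + a7 + a12 + a13 + a16 \<le>
    a1 + a2 + a3 + a4 + a5 + a6 + a7 + a8 + a9 + a10 + a11 + a12 + a13 + a14 + a15 + a16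
      + a17 + a18 + a19 + a20 + a21 + a22 + a23 + a24 + a25 + a26"
    if "0 \<le> a2" "0 \<le> a4" "0 \<le> a8" "0 \<le> a9" "0 \<le> a10" "0 \<le> a11" "0 \<le> a14" "0 \<le> a15"
      "0 \<le> a17" "0 \<le> a18" "0 \<le> a19" "0 \<le> a20" "0 \<le> a21" "0 \<le> a22" "0 \<le> a23" "0 \<le> a24"
      "0 \<le> a25" "0 \<le> a26"
    for a1 a2 a3 a4 a5 a6 a7 a8 a9 a10 a11 a12 a13 a14 a15 a16 a17 a18 a19 a20 a21 a22 a23 a24
      a25 a26 :: real
    using that by linarith
  show ?thesis
    unfolding H2_def
    by (rule drop) (use assms in \<open>simp_all add: sX_nonneg sY_nonneg sE_nonneg\<close>)
qed

text \<open>Arguing by contradiction makes the right-hand side smaller than 1, since two numbers in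
  [0, 1] differ by at most 1. All size conditions on n follow from this.\<close>

lemma single_test:
  fixes N :: "'b measure" and X Y :: "'b \<Rightarrow> real"
    and M :: "'a measure" and Ys Xs :: "nat \<Rightarrow> 'a \<Rightarrow> real" and n :: nat
  defines "mX \<equiv> (\<integral>\<omega>. X \<omega> \<partial>N)" and "mY \<equiv> (\<integral>\<omega>. Y \<omega> \<partial>N)"
  assumes iid: "iid_sample M N n (\<lambda>i \<omega>. (Xs i \<omega> - mX, Ys i \<omega> - mY)) (\<lambda>\<omega>. (Xc N X \<omega>, Yc N Y \<omega>))"
    and c: "berry_esseen_const c" and n: "2 \<le> n"
    and meas[measurable]: "X \<in> borel_measurable N" "Y \<in> borel_measurable N"
    and sq: "integrable N (\<lambda>\<omega>. X \<omega> ^ 2)" "integrable N (\<lambda>\<omega>. Y \<omega> ^ 2)"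
    and cov: "covariance N X Y = 0"
    and fin: "norms_finite N X Y" and den: "denominators_nonzero N X Y"
    and level: "0 < q" "q < 1" "\<gamma> = inv Phi (1 - q / 2)"
  shows "\<bar>\<P>(\<omega> in M. \<gamma> \<le> test_stat d\<^sub>1 d\<^sub>2 d\<^sub>3 n (\<lambda>i. Xs i \<omega>) (\<lambda>i. Ys i \<omega>)) - q\<bar> \<le>
    ln (real n) / sqrt (real n) * (2 * H1 N X Y) + 1 / sqrt (real n) * (2 * H2 N X Y c)"
proof (rule ccontr)
  assume neg: "\<not> ?thesis"
  interpret iid_sample M N n "\<lambda>i \<omega>. (Xs i \<omega> - mX, Ys i \<omega> - mY)" "\<lambda>\<omega>. (Xc N X \<omega>, Yc N Y \<omega>)"
    by fact
  let ?P = "\<P>(\<omega> in M. \<gamma> \<le> test_stat d\<^sub>1 d\<^sub>2 d\<^sub>3 n (\<lambda>i. Xs i \<omega>) (\<lambda>i. Ys i \<omega>))"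
  have c0: "0 < c" using c by (simp add: berry_esseen_const_def)
  have n0: "0 < real n" "0 < sqrt (real n)" "0 < ln (real n)" using n by auto
  have intX: "integrable N X" "integrable N Y"
    using sq by (auto intro: N.square_integrable_imp_integrable)
  have eps: "eps N X Y = Yc N Y"
    by (simp add: eps_def tau_def cov fun_eq_iff)
  have XE: "XE N X Y = (\<lambda>\<omega>. Xc N X \<omega> * Yc N Y \<omega>)"
    by (simp add: eps)
  define a where "a = Lnorm N 2 (XE N X Y)"
  define Q where "Q = Lnorm N 4 (Xc N X) ^ 2"
  define L where "L = Lnorm N 4 (XE N X Y) ^ 2"
  define v where "v = sqrt (varX2E2 N X Y)"
  define k where "k = 1 / Kc N X Y"
  have pos: "0 < sX N X" "0 < sY N Y" "0 < a" "0 < Q" "0 < k" "0 < L" "0 < v"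
    using den sX_nonneg[of N X] sY_nonneg[of N Y] Kc_nonneg[of N X Y] Lnorm_nonneg
    by (auto simp: denominators_nonzero_def a_def Q_def L_def k_def v_def less_le varX2E2_def)
  have sX2: "(\<integral>\<omega>. (Xc N X \<omega>)\<^sup>2 \<partial>N) = (sX N X)\<^sup>2"
    by (simp add: sX_def Xc_def)
  have sY2: "(\<integral>\<omega>. (Yc N Y \<omega>)\<^sup>2 \<partial>N) = (sY N Y)\<^sup>2"
    by (simp add: sY_def Yc_def)
  have a2: "(\<integral>\<omega>. (Xc N X \<omega> * Yc N Y \<omega>)\<^sup>2 \<partial>N) = a\<^sup>2"
    using Lnorm_power[of N "num.Bit0 num.One" "XE N X Y"] by (simp add: a_def eps)
  have Q2: "(\<integral>\<omega>. Xc N X \<omega> ^ 4 \<partial>N) = Q\<^sup>2"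
    using Lnorm_power[of N "num.Bit0 (num.Bit0 num.One)" "Xc N X"] by (simp add: Q_def)
  have L2: "(\<integral>\<omega>. (Xc N X \<omega> * Yc N Y \<omega>) ^ 4 \<partial>N) = L\<^sup>2"
    using Lnorm_power[of N "num.Bit0 (num.Bit0 num.One)" "XE N X Y"] by (simp add: L_def eps)
  have v2: "(\<integral>\<omega>. ((Xc N X \<omega> * Yc N Y \<omega>)\<^sup>2 - a\<^sup>2)\<^sup>2 \<partial>N) = v\<^sup>2"
    using a2 by (simp add: v_def varX2E2_def eps power_mult_distrib)
  have v3: "varX2E2 N X Y powr (3 / 2) = v ^ 3"
  proof -
    have "0 < varX2E2 N X Y" using pos(7) by (simp add: v_def)
    then have "v ^ 3 = (varX2E2 N X Y powr (1 / 2)) powr 3"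
      by (simp add: v_def powr_half_sqrt)
    then show ?thesis by (simp add: powr_powr)
  qed
  have Q3: "Lnorm N 4 (Xc N X) ^ 6 = Q ^ 3"
    by (simp add: Q_def flip: power_mult)
  have Y4: "sqrt (\<integral>\<omega>. Yc N Y \<omega> ^ 4 \<partial>N) = Lnorm N 4 (Yc N Y) ^ 2"
  proof -
    have "(\<integral>\<omega>. Yc N Y \<omega> ^ 4 \<partial>N) = (Lnorm N 4 (Yc N Y) ^ 2)\<^sup>2"
      using Lnorm_power[of N "num.Bit0 (num.Bit0 num.One)" "Yc N Y"] by simp
    then show ?thesis by (simp only: real_sqrt_unique zero_le_power2)
  qed
  have X3: "(\<integral>\<omega>. \<bar>Xc N X \<omega>\<bar> ^ 3 \<partial>N) = Lnorm N 3 (Xc N X) ^ 3"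
    and Y3: "(\<integral>\<omega>. \<bar>Yc N Y \<omega>\<bar> ^ 3 \<partial>N) = Lnorm N 3 (Yc N Y) ^ 3"
    and XY3: "(\<integral>\<omega>. \<bar>Xc N X \<omega> * Yc N Y \<omega>\<bar> ^ 3 \<partial>N) = Lnorm N 3 (XE N X Y) ^ 3"
    and X6: "(\<integral>\<omega>. Xc N X \<omega> ^ 6 \<partial>N) = Lnorm N 6 (Xc N X) ^ 6"
    and XY6: "(\<integral>\<omega>. (Xc N X \<omega> * Yc N Y \<omega>) ^ 6 \<partial>N) = Lnorm N 6 (XE N X Y) ^ 6"
    by (simp_all add: Lnorm_power eps)
  have k2: "4 * L \<le> k * a\<^sup>2"
    using Kc_le(1)[of N X Y] pos unfolding a_def[symmetric] L_def[symmetric] k_def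
    by (simp add: field_simps power2_eq_square)
  have k3: "1152 * Q\<^sup>2 * sY N Y \<le> k * (sX N X ^ 3 * a)"
  proof -
    have "Lnorm N 4 (Xc N X) ^ 4 = Q\<^sup>2" by (simp add: Q_def flip: power_mult)
    then show ?thesis
      using Kc_le(2)[of N X Y] pos unfolding a_def[symmetric] k_def
      by (simp add: field_simps)
  qed
  have ints: "integrable N (\<lambda>\<omega>. Xc N X \<omega> ^ 6)" "integrable N (\<lambda>\<omega>. Yc N Y \<omega> ^ 4)"
      "integrable N (\<lambda>\<omega>. (Xc N X \<omega> * Yc N Y \<omega>) ^ 6)"
      "integrable N (\<lambda>\<omega>. \<bar>Xc N X \<omega>\<bar> ^ 3)" "integrable N (\<lambda>\<omega>. \<bar>Yc N Y \<omega>\<bar> ^ 3)"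
      "integrable N (\<lambda>\<omega>. \<bar>Xc N X \<omega> * Yc N Y \<omega>\<bar> ^ 3)"
      "integrable N (\<lambda>\<omega>. Xc N X \<omega> ^ 4)" "integrable N (\<lambda>\<omega>. (Xc N X \<omega> * Yc N Y \<omega>)\<^sup>2)"
      "integrable N (\<lambda>\<omega>. (Xc N X \<omega> * Yc N Y \<omega>) ^ 4)"
    using fin unfolding norms_finite_def eps by (auto dest!: integrable_finite_Lnorm)
  have int2: "integrable N (\<lambda>\<omega>. (Xc N X \<omega>)\<^sup>2)" "integrable N (\<lambda>\<omega>. (Yc N Y \<omega>)\<^sup>2)"
    using sq intX by (simp_all add: Xc_def Yc_def power2_diff)
  have centered: "(\<integral>\<omega>. Xc N X \<omega> \<partial>N) = 0" "(\<integral>\<omega>. Yc N Y \<omega> \<partial>N) = 0"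
      "(\<integral>\<omega>. Xc N X \<omega> * Yc N Y \<omega> \<partial>N) = 0"
    using intX cov by (simp_all add: Xc_def Yc_def covariance_def N.prob_space)
  define s where "s = c * Lnorm N 3 (XE N X Y) ^ 3 / a ^ 3"
  define sx where "sx = c * Lnorm N 3 (Xc N X) ^ 3 / sX N X ^ 3"
  define sy where "sy = c * Lnorm N 3 (Yc N Y) ^ 3 / sY N Y ^ 3"
  define sw where "sw = c * Lnorm N 6 (XE N X Y) ^ 6 / v ^ 3"
  define ry where "ry = Lnorm N 4 (Yc N Y) ^ 2 / sY N Y ^ 2"
  define rx where "rx = Q / sX N X ^ 2"
  define rz where "rz = Lnorm N 6 (Xc N X) ^ 6 / Q ^ 3"
  have nonneg: "0 \<le> s" "0 \<le> sx" "0 \<le> sy" "0 \<le> sw" "0 \<le> ry" "0 \<le> rx" "0 \<le> rz"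
    using pos c0 by (simp_all add: s_def sx_def sy_def sw_def ry_def rx_def rz_def)
  define h where "h = 19 + 9 * s + 16 * sx + 2 * sw + 6 * sy + 12 * ry + 32 * rx + 16 * rz"
  define l where "l = ln (real n) / sqrt (real n)"
  have l: "0 < l" using n0 by (simp add: l_def)
  have h: "h \<le> H2 N X Y c"
    using H2_ge[OF c0, of N X Y] unfolding v3 Q3 a_def[symmetric] Q_def[symmetric]
    by (simp add: h_def s_def sx_def sy_def sw_def ry_def rx_def rz_def)
  have H1: "k / sqrt (2 * pi) \<le> H1 N X Y"
    using H1_ge[of N X Y] by (simp add: k_def mult.commute)
  have lower: "2 * (l * (k / sqrt (2 * pi))) + 2 * (h / sqrt (real n)) \<le>
      l * (2 * H1 N X Y) + 1 / sqrt (real n) * (2 * H2 N X Y c)"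
    using mult_left_mono[OF H1, of l] divide_right_mono[OF h, of "sqrt (real n)"] l n0 by simp
  have "\<bar>?P - q\<bar> \<le> 1"
    using M.prob_le_1 measure_nonneg level by (smt (verit))
  then have small: "2 * (l * (k / sqrt (2 * pi))) + 2 * (h / sqrt (real n)) < 1"
    using lower neg by (simp add: l_def)
  have "2 * (h / sqrt (real n)) < 1"
  proof -
    have "0 \<le> l * (k / sqrt (2 * pi))" using l pos by simp
    then show ?thesis using small by linarith
  qed
  then have hn: "2 * h < sqrt (real n)" using n0 by (simp add: field_simps)
  \<comment> \<open>38 is twice the constant 19 of \<open>H2\<close>.\<close>
  have "38 < sqrt (real n)" using hn nonneg by (simp add: h_def)
  then have n50: "50 \<le> n"
    using real_le_lsqrt[of 38 "real n"] by (cases "50 \<le> n") auto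
  have "2 * (l * (k / sqrt (2 * pi))) < 1"
  proof -
    have "0 \<le> h / sqrt (real n)" using nonneg n0 by (simp add: h_def)
    then show ?thesis using small by linarith
  qed
  then have "2 * (k * l) < sqrt (2 * pi)"
    by (simp add: field_simps)
  moreover have "sqrt (2 * pi) \<le> 3"
    using pi_less_4 by (intro real_le_lsqrt) auto
  ultimately have kl: "k * l \<le> 3 / 2" by linarith
  have \<gamma>: "0 < \<gamma>" "2 * Phi (- \<gamma>) = q"
    using inv_Phi_level[OF level] by auto
  \<comment> \<open>The sample was centred at the population means; translation invariance returns
    to the observed data.\<close>
  have tr: "test_stat d\<^sub>1 d\<^sub>2 d\<^sub>3 n (\<lambda>i. Xs i \<omega> - mX) (\<lambda>i. Ys i \<omega> - mY) =
      test_stat d\<^sub>1 d\<^sub>2 d\<^sub>3 n (\<lambda>i. Xs i \<omega>) (\<lambda>i. Ys i \<omega>)" for d\<^sub>1 d\<^sub>2 d\<^sub>3 \<omega>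
    using test_stat_translate[of n d\<^sub>1 d\<^sub>2 d\<^sub>3 "\<lambda>i. Xs i \<omega> - mX" mX "\<lambda>i. Ys i \<omega> - mY" mY] n by simp
  have Qn: "64 * (Q / (sX N X)\<^sup>2) \<le> sqrt (real n)"
    using hn nonneg unfolding rx_def[symmetric] by (simp add: h_def)
  have Y4n: "16 * (sqrt (\<integral>\<omega>. Yc N Y \<omega> ^ 4 \<partial>N) / (sY N Y)\<^sup>2) \<le> sqrt (real n)"
    using hn nonneg unfolding Y4 ry_def[symmetric] by (simp add: h_def)
  have "\<bar>?P - q\<bar> \<le> 2 * k * l / sqrt (2 * pi) +
    (8 + 2 * c * (Lnorm N 3 (Xc N X) ^ 3 / sX N X ^ 3) + 2 * c * (Lnorm N 3 (Yc N Y) ^ 3 / sY N Y ^ 3)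
      + 4 * c * (Lnorm N 3 (XE N X Y) ^ 3 / a ^ 3)
      + 4 * c * (Lnorm N 6 (XE N X Y) ^ 6 / v ^ 3)
      + 2 * (Lnorm N 6 (Xc N X) ^ 6 / Q ^ 3) + Q / (sX N X)\<^sup>2 + Lnorm N 4 (Yc N Y) ^ 2 / (sY N Y)\<^sup>2) / sqrt (real n)"
    using test_stat_berry_esseen[OF iid c, unfolded fst_conv snd_conv,
        OF ints(1-6) int2 ints(7-9) centered sX2 sY2 a2 Q2 L2 v2 pos \<gamma>(1) k2 k3 n50
          kl[unfolded l_def] Qn Y4n]
    unfolding tr \<gamma>(2) X3 Y3 XY3 X6 XY6 Y4 l_def by blast
  also have "\<dots> = 2 * (l * (k / sqrt (2 * pi))) +
    (8 + 2 * sx + 2 * sy + 4 * s + 4 * sw + 2 * rz + rx + ry) / sqrt (real n)"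
    by (simp add: s_def sx_def sy_def sw_def ry_def rx_def rz_def mult.assoc mult.commute[of l k])
  \<comment> \<open>Against 2 h every coefficient has slack except that of \<open>sw\<close>, where
    4 meets 2 * 2.\<close>
  also have "\<dots> \<le> 2 * (l * (k / sqrt (2 * pi))) + (2 * h) / sqrt (real n)"
    using nonneg n0 by (intro add_left_mono divide_right_mono) (auto simp: h_def)
  finally show False
    using lower neg by (simp add: l_def)
qed

text \<open>The pairs are images of the observation vectors under one measurable map, which
  preserves independence and equality of laws. The shifts are left free: the population means serve
  the test, zero serves measurability.\<close>

lemma iid_sample_obs:
  assumes "prob_space M" "prob_space N" "1 \<le> n" and j: "j \<in> {1..p}"
    and Y: "Y \<in> borel_measurable N" and X: "\<And>j. j \<in> {1..p} \<Longrightarrow> X j \<in> borel_measurable N"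
    and ind: "prob_space.indep_vars M (\<lambda>_. obs_space p) (\<lambda>i. obs p (Ys i) (\<lambda>j. Xs i j)) {1..n}"
    and dist: "\<And>i. i \<in> {1..n} \<Longrightarrow>
         distr M (obs_space p) (obs p (Ys i) (\<lambda>j. Xs i j)) = distr N (obs_space p) (obs p Y X)"
  shows "iid_sample M N n (\<lambda>i \<omega>. (Xs i j \<omega> - b, Ys i \<omega> - c)) (\<lambda>\<omega>. (X j \<omega> - b, Y \<omega> - c))"
proof -
  interpret M: prob_space M by fact
  define g where "g = (\<lambda>z :: real \<times> (nat \<Rightarrow> real). (snd z j - b, fst z - c))"
  have g: "g \<in> measurable (obs_space p) borel"
  proof -
    have [measurable]: "(\<lambda>z. snd z j) \<in> borel_measurable (obs_space p)"
      unfolding obs_space_def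
      by (rule measurable_compose[OF measurable_snd measurable_component_singleton[OF j]])
    have [measurable]: "fst \<in> borel_measurable (obs_space p)"
      unfolding obs_space_def by (rule measurable_fst)
    show ?thesis unfolding g_def by measurable
  qed
  have oM: "obs p (Ys i) (\<lambda>j. Xs i j) \<in> measurable M (obs_space p)" if "i \<in> {1..n}" for i
    using ind that by (auto simp: M.indep_vars_def)
  have oN: "obs p Y X \<in> measurable N (obs_space p)"
    unfolding obs_def obs_space_def using Y X
    by (intro measurable_Pair measurable_restrict) auto
  show ?thesis
  proof (rule iid_sample.intro)
    show "M.indep_vars (\<lambda>_. borel) (\<lambda>i \<omega>. (Xs i j \<omega> - b, Ys i \<omega> - c)) {1..n}"
      using M.indep_vars_compose2[OF ind, of "\<lambda>_. g" "\<lambda>_. borel"] g j by (simp add: g_def obs_def)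
    show "(\<lambda>\<omega>. (X j \<omega> - b, Y \<omega> - c)) \<in> borel_measurable N"
      using measurable_compose[OF oN g] j by (simp add: g_def obs_def)
    fix i assume i: "i \<in> {1..n}"
    have "distr M borel (\<lambda>\<omega>. (Xs i j \<omega> - b, Ys i \<omega> - c)) = distr (distr M (obs_space p) (obs p (Ys i) (\<lambda>j. Xs i j))) borel g"
      using j by (subst distr_distr[OF g oM[OF i]]) (simp add: g_def obs_def comp_def)
    also have "\<dots> = distr N borel (\<lambda>\<omega>. (X j \<omega> - b, Y \<omega> - c))"
      using j by (subst dist[OF i], subst distr_distr[OF g oN]) (simp add: g_def obs_def comp_def)
    finally show "distr M borel (\<lambda>\<omega>. (Xs i j \<omega> - b, Ys i \<omega> - c)) = distr N borel (\<lambda>\<omega>. (X j \<omega> - b, Y \<omega> - c))" .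
  qed fact+
qed

text \<open>The expected proportion is the average of the individual rejection probabilities, by
  linearity of expectation; the tests may depend on each other in any way. Each probability is
  within the common bound of q.\<close>

theorem proposition3p2:
  fixes N :: "'b measure" and Y :: "'b \<Rightarrow> real" and X :: "nat \<Rightarrow> 'b \<Rightarrow> real"
    and M :: "'a measure" and Ys :: "nat \<Rightarrow> 'a \<Rightarrow> real" and Xs :: "nat \<Rightarrow> nat \<Rightarrow> 'a \<Rightarrow> real"
    and n p :: nat and q \<gamma> :: real
    and c\<^sub>B\<^sub>E c\<^sub>1\<^sub>R c\<^sub>2\<^sub>R :: real
    and d\<^sub>1 d\<^sub>2 d\<^sub>3 :: real
    and Mstar Mc :: "nat set" and Mhat :: "'a \<Rightarrow> nat set"
  assumes constants: "berry_esseen_const c\<^sub>B\<^sub>E" "rosenthal_consts c\<^sub>1\<^sub>R c\<^sub>2\<^sub>R"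
    and np: "2 \<le> n" "1 \<le> p"
    and generic: "prob_space N"
      "Y \<in> borel_measurable N" "integrable N (\<lambda>\<omega>. Y \<omega> ^ 2)"
      "\<And>j. j \<in> {1..p} \<Longrightarrow> X j \<in> borel_measurable N"
      "\<And>j. j \<in> {1..p} \<Longrightarrow> integrable N (\<lambda>\<omega>. X j \<omega> ^ 2)"
      "\<And>j. j \<in> {1..p} \<Longrightarrow> 0 < prob_space.variance N (X j)"
    and sample: "prob_space M"
      "prob_space.indep_vars M (\<lambda>_. obs_space p) (\<lambda>i. obs p (Ys i) (\<lambda>j. Xs i j)) {1..n}"
      "\<And>i. i \<in> {1..n} \<Longrightarrow>
         distr M (obs_space p) (obs p (Ys i) (\<lambda>j. Xs i j)) = distr N (obs_space p) (obs p Y X)"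
    and level: "0 < q" "q < 1"
    and gamma: "\<gamma> = inv Phi (1 - q / 2)"
    and Mstar: "Mstar = {j \<in> {1..p}. covariance N (X j) Y \<noteq> 0}"
    and Mc: "Mc = {1..p} - Mstar" "Mc \<noteq> {}"
    and Mhat: "\<And>\<omega>. Mhat \<omega> = {j \<in> {1..p}.
           test_stat d\<^sub>1 d\<^sub>2 d\<^sub>3 n (\<lambda>i. Xs i j \<omega>) (\<lambda>i. Ys i \<omega>) \<ge> \<gamma>}"
    and moments: "\<And>j. j \<in> Mc \<Longrightarrow> norms_finite N (X j) Y"
      "\<And>j. j \<in> Mc \<Longrightarrow> denominators_nonzero N (X j) Y"
  shows "\<bar>prob_space.expectation M (\<lambda>\<omega>. real (card (Mc \<inter> Mhat \<omega>)) / real (card Mc)) - q\<bar>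
    \<le> ln (real n) / sqrt (real n) * (MAX j\<in>Mc. 2 * H1 N (X j) Y)
      + 1 / sqrt (real n) * (MAX j\<in>Mc. 2 * H2 N (X j) Y c\<^sub>B\<^sub>E)
      + 1 / sqrt (real n * ln (real n)) * (MAX j\<in>Mc. 2 * H3 N (X j) Y)
      + 1 / real n * (MAX j\<in>Mc. 2 * H4 N (X j) Y c\<^sub>1\<^sub>R)
      + 1 / real n powr (3 / 2) * (MAX j\<in>Mc. 2 * H5 N (X j) Y c\<^sub>2\<^sub>R)"
proof -
  interpret M: prob_space M by (rule sample(1))
  define P where "P j = \<P>(\<omega> in M. \<gamma> \<le> test_stat d\<^sub>1 d\<^sub>2 d\<^sub>3 n (\<lambda>i. Xs i j \<omega>) (\<lambda>i. Ys i \<omega>))" for j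
  define B where "B j = ln (real n) / sqrt (real n) * (2 * H1 N (X j) Y)
      + 1 / sqrt (real n) * (2 * H2 N (X j) Y c\<^sub>B\<^sub>E)
      + 1 / sqrt (real n * ln (real n)) * (2 * H3 N (X j) Y)
      + 1 / real n * (2 * H4 N (X j) Y c\<^sub>1\<^sub>R)
      + 1 / real n powr (3 / 2) * (2 * H5 N (X j) Y c\<^sub>2\<^sub>R)" for j
  define R where "R = ln (real n) / sqrt (real n) * (MAX j\<in>Mc. 2 * H1 N (X j) Y)
      + 1 / sqrt (real n) * (MAX j\<in>Mc. 2 * H2 N (X j) Y c\<^sub>B\<^sub>E)
      + 1 / sqrt (real n * ln (real n)) * (MAX j\<in>Mc. 2 * H3 N (X j) Y)
      + 1 / real n * (MAX j\<in>Mc. 2 * H4 N (X j) Y c\<^sub>1\<^sub>R)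
      + 1 / real n powr (3 / 2) * (MAX j\<in>Mc. 2 * H5 N (X j) Y c\<^sub>2\<^sub>R)"
  have n: "1 \<le> n" "0 \<le> ln (real n)" using np by auto
  have Mc_sub: "Mc \<subseteq> {1..p}" and fin: "finite Mc" using Mc by auto
  have card: "0 < real (card Mc)" using fin Mc by (simp add: card_gt_0_iff)
  have iid: "iid_sample M N n (\<lambda>i \<omega>. (Xs i j \<omega> - b, Ys i \<omega> - c)) (\<lambda>\<omega>. (X j \<omega> - b, Y \<omega> - c))"
    if "j \<in> Mc" for j b c
    by (rule iid_sample_obs[OF sample(1) generic(1) n(1) _ generic(2,4) sample(2,3)])
       (use that Mc_sub in auto)
  have le_B: "\<bar>P j - q\<bar> \<le> B j" if j: "j \<in> Mc" for j
  proof -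
    have jp: "j \<in> {1..p}" using j Mc_sub by auto
    have cov: "covariance N (X j) Y = 0" using j Mc Mstar by auto
    have iid_j: "iid_sample M N n
        (\<lambda>i \<omega>. (Xs i j \<omega> - (\<integral>\<omega>. X j \<omega> \<partial>N), Ys i \<omega> - (\<integral>\<omega>. Y \<omega> \<partial>N)))
        (\<lambda>\<omega>. (Xc N (X j) \<omega>, Yc N Y \<omega>))"
      unfolding Xc_def Yc_def by (rule iid[OF j])
    have "\<bar>P j - q\<bar> \<le> ln (real n) / sqrt (real n) * (2 * H1 N (X j) Y)
        + 1 / sqrt (real n) * (2 * H2 N (X j) Y c\<^sub>B\<^sub>E)"
      unfolding P_def
      by (rule single_test[OF iid_j constants(1) np(1) generic(4)[OF jp] generic(2)
            generic(5)[OF jp] generic(3) cov moments(1,2)[OF j] level gamma])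
    also have "\<dots> \<le> B j"
      using n H3_nonneg[of N "X j" Y] H4_nonneg[of N "X j" Y] H5_nonneg[of N "X j" Y]
      unfolding B_def by (simp add: add_increasing2)
    finally show ?thesis .
  qed
  \<comment> \<open>The five maxima are taken separately, and together they dominate the bound of
    each single covariate.\<close>
  have B_le: "B j \<le> R" if "j \<in> Mc" for j
    unfolding B_def R_def using n that fin
    by (intro add_mono mult_left_mono Max_ge) auto
  have T: "(\<lambda>\<omega>. test_stat d\<^sub>1 d\<^sub>2 d\<^sub>3 n (\<lambda>i. Xs i j \<omega>) (\<lambda>i. Ys i \<omega>)) \<in> borel_measurable M"
    if j: "j \<in> Mc" for j
  proof -
    \<comment> \<open>With zero shifts the pairs are the raw observations, whose measurability is
      part of the independence statement.\<close>
    interpret iid_sample M N n "\<lambda>i \<omega>. (Xs i j \<omega> - 0, Ys i \<omega> - 0)" "\<lambda>\<omega>. (X j \<omega> - 0, Y \<omega> - 0)"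
      by (rule iid[OF j])
    have "(\<lambda>\<omega>. (Xs i j \<omega>, Ys i \<omega>)) \<in> M \<rightarrow>\<^sub>M borel \<Otimes>\<^sub>M borel" if "i \<in> {1..n}" for i
      using U_measurable[OF that] by (simp add: borel_prod)
    then show ?thesis
      by (intro measurable_test_stat) (auto dest!: measurable_fst'' measurable_snd'')
  qed
  define A where "A j = {\<omega> \<in> space M. \<gamma> \<le> test_stat d\<^sub>1 d\<^sub>2 d\<^sub>3 n (\<lambda>i. Xs i j \<omega>) (\<lambda>i. Ys i \<omega>)}" for j
  have A: "A j \<in> sets M" if "j \<in> Mc" for j
    unfolding A_def using T[OF that] by measurable
  have "M.expectation (\<lambda>\<omega>. real (card (Mc \<inter> Mhat \<omega>)) / real (card Mc)) =
      M.expectation (\<lambda>\<omega>. (\<Sum>j\<in>Mc. indicator (A j) \<omega>) / real (card Mc))"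
  proof (rule Bochner_Integration.integral_cong[OF refl])
    fix \<omega> assume "\<omega> \<in> space M"
    then have "indicator (A j) \<omega> = (if j \<in> Mhat \<omega> then 1 else 0 :: real)" if "j \<in> Mc" for j
      using that Mc_sub by (auto simp: A_def Mhat)
    then have "(\<Sum>j\<in>Mc. indicator (A j) \<omega> :: real) = real (card (Mc \<inter> Mhat \<omega>))"
      using fin by (simp add: sum.If_cases)
    then show "real (card (Mc \<inter> Mhat \<omega>)) / real (card Mc) = (\<Sum>j\<in>Mc. indicator (A j) \<omega>) / real (card Mc)"
      by simp
  qed
  also have "\<dots> = (\<Sum>j\<in>Mc. P j) / real (card Mc)"
  proof -
    have "M.expectation (\<lambda>\<omega>. \<Sum>j\<in>Mc. indicator (A j) \<omega>) = (\<Sum>j\<in>Mc. M.prob (A j))"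
      using A by (subst Bochner_Integration.integral_sum) (auto simp: less_top[symmetric])
    then show ?thesis by (simp add: A_def P_def)
  qed
  also have "\<dots> = (\<Sum>j\<in>Mc. P j - q) / real (card Mc) + q"
    using card by (simp add: sum_subtractf field_simps)
  finally have "\<bar>M.expectation (\<lambda>\<omega>. real (card (Mc \<inter> Mhat \<omega>)) / real (card Mc)) - q\<bar> =
      \<bar>\<Sum>j\<in>Mc. P j - q\<bar> / real (card Mc)"
    by simp
  also have "\<dots> \<le> (\<Sum>j\<in>Mc. R) / real (card Mc)"
    by (intro divide_right_mono order_trans[OF sum_abs] sum_mono order_trans[OF le_B B_le]) auto
  also have "\<dots> = R" using card by simp
  finally show ?thesis unfolding R_def .
qed

end
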